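(* For every $\gamma>0$ and $m\ge0$ there exists a constant $C=C(m,\gamma)>0$ such that $$\lambda^{*,m}(\mathcal{E},N)\ \ge\ C\,\kappa_m\,N^{-2}\,\lambda^{*,m}_{LR}(\mathcal{E},N)\qquad\text{for all }\mathcal{E}>0,\ N\ge2.$$
   Context: Fix $\gamma>0$. $\nu^{\gamma}(dx)=x^{\gamma-1}e^{-x}\Gamma(\gamma)^{-1}dx$ on $(0,\infty)$; $\mathcal{S}_{\mathcal{E},N}=\{x\in(0,\infty)^N:\frac1N\sum_i x_i=\mathcal{E}\}$; $\nu_{\mathcal{E},N}=\nu^\gamma_{\mathcal{E},N}$ is the conditional law of $(\nu^\gamma)^{\otimes N}$ on $\mathcal{S}_{\mathcal{E},N}$. $\mu^\gamma$ is the Beta$(\gamma,\gamma)$ law on $[0,1]$. $T_{i,j,\alpha}x$ replaces $x_i$ by $\alpha(x_i+x_j)$ and $x_j$ by $(1-\alpha)(x_i+x_j)$. $E_{i,j}f(x)=\int\mu^\gamma(d\alpha)f(T_{i,j,\alpha}x)$, $D_{i,j}f=E_{i,j}f-f$. Nearest-neighbour Dirichlet form $\mathcal{D}^{*,m}_{\mathcal{E},N}(f)=\sum_{i=1}^{N-1}E_{\nu_{\mathcal{E},N}}[(x_i+x_{i+1})^m(D_{i,i+1}f)^2]$; long-range Dirichlet form $\mathcal{D}^{*,m}_{LR,\mathcal{E},N}(f)=\frac1N\sum_{1\le i<j\le N}E_{\nu_{\mathcal{E},N}}[(x_i+x_j)^m(D_{i,j}f)^2]$. $\lambda^{*,m}(\mathcal{E},N)$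 (resp. $\lambda^{*,m}_{LR}(\mathcal{E},N)$) is the infimum of $\mathcal{D}^{*,m}_{\mathcal{E},N}(f)/E_{\nu_{\mathcal{E},N}}[f^2]$ (resp. $\mathcal{D}^{*,m}_{LR,\mathcal{E},N}(f)/E_{\nu_{\mathcal{E},N}}[f^2]$) over nonzero $f\in L^2(\nu_{\mathcal{E},N})$ with $E_{\nu_{\mathcal{E},N}}[f]=0$. Set $\kappa_m=\lambda^{*,m}(\frac13,3)$ (depends also on $\gamma$). *)

theory Defs
  imports "HOL-Analysis.Analysis"
begin

text \<open>Configurations x in (0,inf)^N are represented as functions nat => real,
  with coordinates 0..N-1 (extensional: value undefined outside {..<N}).\<close>

definition config_space :: "nat \<Rightarrow> (nat \<Rightarrow> real) measure" where
  "config_space N = PiM {..<N} (\<lambda>_. borel)"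

definition simplex_param :: "real \<Rightarrow> nat \<Rightarrow> (nat \<Rightarrow> real) \<Rightarrow> (nat \<Rightarrow> real)" where
  "simplex_param E N y = (\<lambda>i. if i < N - 1 then y i
                              else if i = N - 1 then real N * E - (\<Sum>k<N - 1. y k)
                              else undefined)"

text \<open>Unnormalised density of the conditional law of (nu^gamma)^{\<otimes>N} on S_{E,N}
  w.r.t. Lebesgue measure on the first N-1 coordinates: the product density
  prod x_i^(gamma-1) e^(-x_i), where e^(-sum x_i) = e^(-N E) is constant on S_{E,N}.\<close>
definition cond_weight :: "real \<Rightarrow> real \<Rightarrow> nat \<Rightarrow> (nat \<Rightarrow> real) \<Rightarrow> real" where
  "cond_weight \<gamma> E N y =
     (let x = simplex_param E N y in
      if (\<forall>i<N. 0 < x i) then (\<Prod>i<N. x i powr (\<gamma> - 1)) else 0)"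

definition cond_norm :: "real \<Rightarrow> real \<Rightarrow> nat \<Rightarrow> ennreal" where
  "cond_norm \<gamma> E N = (\<integral>\<^sup>+ y. ennreal (cond_weight \<gamma> E N y) \<partial>(PiM {..<N - 1} (\<lambda>_. lborel)))"

text \<open>nu_{E,N} = nu^gamma_{E,N}: conditional law of the i.i.d. Gamma(gamma) vector on S_{E,N}.\<close>
definition nu_cond :: "real \<Rightarrow> real \<Rightarrow> nat \<Rightarrow> (nat \<Rightarrow> real) measure" where
  "nu_cond \<gamma> E N =
     distr (density (PiM {..<N - 1} (\<lambda>_. lborel))
                    (\<lambda>y. ennreal (cond_weight \<gamma> E N y) / cond_norm \<gamma> E N))
           (config_space N) (simplex_param E N)"

definition beta_sym :: "real \<Rightarrow> real measure" where
  "beta_sym \<gamma> = density lborel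
     (\<lambda>a. ennreal (indicator {0<..<1} a * a powr (\<gamma> - 1) * (1 - a) powr (\<gamma> - 1)
                  / Beta \<gamma> \<gamma>))"

definition Tmove :: "nat \<Rightarrow> nat \<Rightarrow> real \<Rightarrow> (nat \<Rightarrow> real) \<Rightarrow> (nat \<Rightarrow> real)" where
  "Tmove i j \<alpha> x = x(i := \<alpha> * (x i + x j), j := (1 - \<alpha>) * (x i + x j))"

definition Eop :: "real \<Rightarrow> nat \<Rightarrow> nat \<Rightarrow> ((nat \<Rightarrow> real) \<Rightarrow> real) \<Rightarrow> (nat \<Rightarrow> real) \<Rightarrow> real" where
  "Eop \<gamma> i j f x = (\<integral>\<alpha>. f (Tmove i j \<alpha> x) \<partial>(beta_sym \<gamma>))"

definition Dop :: "real \<Rightarrow> nat \<Rightarrow> nat \<Rightarrow> ((nat \<Rightarrow> real) \<Rightarrow> real) \<Rightarrow> (nat \<Rightarrow> real) \<Rightarrow> real" where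
  "Dop \<gamma> i j f x = Eop \<gamma> i j f x - f x"

text \<open>Dirichlet forms (values in [0,inf], nonnegative integrals). Index i=1..N-1 of the
  paper corresponds to i=0..N-2 here.\<close>
definition dirichlet_nn :: "real \<Rightarrow> real \<Rightarrow> real \<Rightarrow> nat \<Rightarrow> ((nat \<Rightarrow> real) \<Rightarrow> real) \<Rightarrow> ennreal" where
  "dirichlet_nn \<gamma> m E N f =
     (\<Sum>i<N - 1. \<integral>\<^sup>+ x. ennreal ((x i + x (Suc i)) powr m * (Dop \<gamma> i (Suc i) f x)\<^sup>2) \<partial>(nu_cond \<gamma> E N))"

definition dirichlet_lr :: "real \<Rightarrow> real \<Rightarrow> real \<Rightarrow> nat \<Rightarrow> ((nat \<Rightarrow> real) \<Rightarrow> real) \<Rightarrow> ennreal" where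
  "dirichlet_lr \<gamma> m E N f =
     ennreal (1 / real N) *
     (\<Sum>(i,j)\<in>{(i,j). i < j \<and> j < N}.
        \<integral>\<^sup>+ x. ennreal ((x i + x j) powr m * (Dop \<gamma> i j f x)\<^sup>2) \<partial>(nu_cond \<gamma> E N))"

definition test_fns :: "real \<Rightarrow> real \<Rightarrow> nat \<Rightarrow> ((nat \<Rightarrow> real) \<Rightarrow> real) set" where
  "test_fns \<gamma> E N = {f. f \<in> borel_measurable (nu_cond \<gamma> E N)
       \<and> integrable (nu_cond \<gamma> E N) (\<lambda>x. (f x)\<^sup>2)
       \<and> (\<integral>x. f x \<partial>(nu_cond \<gamma> E N)) = 0
       \<and> (\<integral>x. (f x)\<^sup>2 \<partial>(nu_cond \<gamma> E N)) \<noteq> 0}"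

definition gap_nn :: "real \<Rightarrow> real \<Rightarrow> real \<Rightarrow> nat \<Rightarrow> ennreal" where
  "gap_nn \<gamma> m E N = (INF f\<in>test_fns \<gamma> E N.
      dirichlet_nn \<gamma> m E N f / ennreal (\<integral>x. (f x)\<^sup>2 \<partial>(nu_cond \<gamma> E N)))"

definition gap_lr :: "real \<Rightarrow> real \<Rightarrow> real \<Rightarrow> nat \<Rightarrow> ennreal" where
  "gap_lr \<gamma> m E N = (INF f\<in>test_fns \<gamma> E N.
      dirichlet_lr \<gamma> m E N f / ennreal (\<integral>x. (f x)\<^sup>2 \<partial>(nu_cond \<gamma> E N)))"

definition kappa :: "real \<Rightarrow> real \<Rightarrow> ennreal" where
  "kappa \<gamma> m = gap_nn \<gamma> m (1/3) 3"

end

theory Submission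
  imports Defs "HOL-Probability.Probability"
begin

text \<open>
  The conditional law is the law of a normalised vector of independent Gamma variables, whose direction is
  independent of its sum. Hence it is invariant under permutations of the sites and under resampling the
  proportions within any block of sites.

  It remains to bound a long-range term with weight \<open>(x\<^sub>i + x\<^sub>j)\<^sup>m\<close> by nearest-neighbour terms. For \<open>h\<close>
  invariant under the moves of \<open>i, j\<close> the term is at most the weighted square of \<open>f - h\<close>, and
  \<open>(x\<^sub>i + x\<^sub>j)\<^sup>m \<le> 2\<^sup>m (x\<^sub>i\<^sup>m + x\<^sub>j\<^sup>m)\<close>, so the weights \<open>x\<^sub>i\<^sup>m\<close> and \<open>x\<^sub>j\<^sup>m\<close> can be treated separately. Take \<open>h\<close>
  to be the nearest-neighbour average at \<open>j - 1, j\<close> after \<open>x\<^sub>i\<close> has been carried to \<open>j - 1\<close>. Under the weight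
  \<open>x\<^sub>i\<^sup>m\<close>, carry \<open>x\<^sub>i\<close> up by transpositions. Under \<open>x\<^sub>j\<^sup>m\<close>, first carry \<open>x\<^sub>j\<close> down to \<open>i + 1\<close> and then move the pair
  up to \<open>j - 1, j\<close> by rotations of three sites, each of which is controlled by the three-site gap \<open>\<kappa>\<^sub>m\<close>. Every
  move involves the site whose energy is the weight, so the local rates never degenerate along the path.
\<close>

section \<open>The conditional law and independent Gamma variables\<close>

text \<open>On the simplex one coordinate depends on all the others, so a permutation or a
  resampling of sites would need a change of variables there. For a normalised Gamma vector every
  invariance is checked on independent coordinates.

  The function \<open>h\<close> has to be the same under both weights, since otherwise the two
  bounds could not be added. Under the weight of \<open>j\<close> this forces the energy of
  \<open>i\<close> past all energies between \<open>i\<close> and \<open>j\<close>. But adjacent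
  transpositions that all move the energy of \<open>j\<close> never change the order of the other
  energies. Some step must therefore reorder two energies while that of \<open>j\<close> merely
  stands next to them, and three sites are the smallest block in which it still enters the weight.

  The factor \<open>N^2\<close> arises as follows: Cauchy-Schwarz along a path of at most
  \<open>N\<close> steps costs \<open>N\<close>, each bond is used boundedly often, and at most
  \<open>N^2\<close> pairs carry the prefactor \<open>1 / N\<close>. Transposition steps come
  without a factor \<open>kappa\<close>; there \<open>kappa\<close> is replaced by an upper bound
  \<open>K\<close>, so the constant involves its value and its finiteness has to be proved.\<close>

definition gamma_dens :: "real \<Rightarrow> real \<Rightarrow> real" where
  "gamma_dens a t = indicator {0..} t * t powr (a - 1) / exp t"

definition gamma_law :: "real \<Rightarrow> real measure" where
  "gamma_law a = density lborel (\<lambda>t. ennreal (gamma_dens a t / Gamma a))"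

definition scale_config :: "nat \<Rightarrow> real \<Rightarrow> (nat \<Rightarrow> real) \<Rightarrow> nat \<Rightarrow> real" where
  "scale_config N c x = (\<lambda>i. if i < N then c * x i else undefined)"

lemma gamma_dens_nonneg [simp]: "0 \<le> gamma_dens a t"
  by (simp add: gamma_dens_def)

lemma measurable_gamma_dens [measurable]: "gamma_dens a \<in> borel_measurable borel"
  unfolding gamma_dens_def[abs_def] by measurable

lemma nn_integral_gamma_dens: "a > 0 \<Longrightarrow> (\<integral>\<^sup>+t. ennreal (gamma_dens a t) \<partial>lborel) = ennreal (Gamma a)"
  unfolding gamma_dens_def by (rule Gamma_conv_nn_integral_real[symmetric])

lemma sets_gamma_law [measurable_cong, simp]: "sets (gamma_law a) = sets borel"
  by (simp add: gamma_law_def)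

lemma space_gamma_law [simp]: "space (gamma_law a) = UNIV"
  by (simp add: gamma_law_def)

lemma nn_integral_gamma_dens_div:
  assumes "a > 0" shows "(\<integral>\<^sup>+t. ennreal (gamma_dens a t / Gamma a) \<partial>lborel) = 1"
proof -
  have "(\<integral>\<^sup>+t. ennreal (gamma_dens a t / Gamma a) \<partial>lborel) = (\<integral>\<^sup>+t. ennreal (gamma_dens a t) / ennreal (Gamma a) \<partial>lborel)"
    using assms by (intro nn_integral_cong) (simp add: divide_ennreal)
  also have "\<dots> = ennreal (Gamma a) / ennreal (Gamma a)"
    using assms by (subst nn_integral_divide) (simp_all add: nn_integral_gamma_dens)
  also have "\<dots> = 1"
    using Gamma_real_pos[OF assms] by (simp add: divide_ennreal)
  finally show ?thesis .
qed

lemma prob_space_gamma_law: "a > 0 \<Longrightarrow> prob_space (gamma_law a)"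
  by (rule prob_spaceI) (simp add: gamma_law_def emeasure_density nn_integral_gamma_dens_div)

lemma space_config_space: "space (config_space N) = extensional {..<N}"
  by (simp add: config_space_def space_PiM PiE_def)

lemma sets_PiM_lborel_config [measurable_cong]: "sets (PiM {..<n} (\<lambda>_. lborel)) = sets (config_space n)"
  unfolding config_space_def by (rule sets_PiM_cong) simp_all

lemma sets_PiM_gamma_config [measurable_cong]: "sets (PiM {..<n} (\<lambda>_. gamma_law a)) = sets (config_space n)"
  unfolding config_space_def by (rule sets_PiM_cong) simp_all

lemma measurable_config_component [measurable (raw)]:
  "i < N \<Longrightarrow> (\<lambda>x. x i) \<in> borel_measurable (config_space N)"
  unfolding config_space_def by (rule measurable_component_singleton) simp

lemma measurable_config_component' [measurable_dest]:
  assumes "f \<in> measurable M (config_space N)" "g \<in> measurable L M" "i < N"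
  shows "(\<lambda>x. f (g x) i) \<in> borel_measurable L"
  using measurable_compose[OF measurable_compose[OF assms(2,1)] measurable_config_component[OF assms(3)]] .

lemma measurable_configI:
  assumes "\<And>i. i < N \<Longrightarrow> (\<lambda>\<omega>. f \<omega> i) \<in> borel_measurable M"
    and "\<And>\<omega> i. \<omega> \<in> space M \<Longrightarrow> \<not> i < N \<Longrightarrow> f \<omega> i = undefined"
  shows "f \<in> measurable M (config_space N)"
  unfolding config_space_def
  using assms by (intro measurable_PiM_single'[of "{..<N}" "\<lambda>i \<omega>. f \<omega> i", simplified])
    (auto simp: PiE_def extensional_def)

lemma measurable_simplex_param:
  assumes "N \<ge> 1"
  shows "simplex_param E N \<in> measurable (config_space (N - 1)) (config_space N)"
proof -
  obtain n where n: "N = Suc n" using assms by (cases N) auto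
  have "(\<lambda>\<omega>. simplex_param E N \<omega> i) \<in> borel_measurable (config_space n)" if "i < N" for i
    by (cases "i < n") (use that in \<open>auto simp: simplex_param_def n\<close>)
  then show ?thesis
    using assms by (intro measurable_configI) (auto simp: n simplex_param_def)
qed

lemma measurable_simplex_param_pair:
  assumes "N \<ge> 1"
  shows "(\<lambda>(E, y). simplex_param E N y) \<in> measurable (borel \<Otimes>\<^sub>M config_space (N - 1)) (config_space N)"
proof -
  obtain n where n: "N = Suc n" using assms by (cases N) auto
  have "(\<lambda>\<omega>. simplex_param (fst \<omega>) N (snd \<omega>) i) \<in> borel_measurable (borel \<Otimes>\<^sub>M config_space n)" if "i < N" for i
    by (cases "i < n") (use that in \<open>auto simp: simplex_param_def n\<close>)
  then show ?thesis
    using assms by (intro measurable_configI) (auto simp: n simplex_param_def split_beta')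
qed

lemma measurable_scale_config:
  "(\<lambda>(c, x). scale_config N c x) \<in> measurable (borel \<Otimes>\<^sub>M config_space N) (config_space N)"
  unfolding scale_config_def by (rule measurable_configI) (auto simp: split_beta')

lemma measurable_scale_config1 [measurable]:
  "scale_config N c \<in> measurable (config_space N) (config_space N)"
  unfolding scale_config_def by (rule measurable_configI) auto

lemma measurable_cond_weight [measurable]:
  assumes "N \<ge> 1"
  shows "cond_weight \<gamma> E N \<in> borel_measurable (config_space (N - 1))"
proof -
  note measurable_simplex_param[OF assms, measurable]
  show ?thesis unfolding cond_weight_def[abs_def] Let_def by measurable
qed

lemma cond_weight_nonneg [simp]: "0 \<le> cond_weight \<gamma> E N y"
  by (auto simp: cond_weight_def Let_def intro!: prod_nonneg)

lemma sum_simplex_param: "N \<ge> 1 \<Longrightarrow> (\<Sum>i<N. simplex_param E N y i) = real N * E"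
proof -
  assume "N \<ge> 1"
  then obtain n where n: "N = Suc n" by (cases N) auto
  have "(\<Sum>i<n. simplex_param E N y i) = (\<Sum>i<n. y i)"
    by (rule sum.cong) (auto simp: simplex_param_def n)
  then show ?thesis by (simp add: n simplex_param_def)
qed

section \<open>Unnormalised integrals over the simplex and their scaling\<close>

definition simplex_int :: "real \<Rightarrow> real \<Rightarrow> nat \<Rightarrow> ((nat \<Rightarrow> real) \<Rightarrow> ennreal) \<Rightarrow> ennreal" where
  "simplex_int \<gamma> E N \<phi> = (\<integral>\<^sup>+y. \<phi> (simplex_param E N y) * ennreal (cond_weight \<gamma> E N y) \<partial>PiM {..<N - 1} (\<lambda>_. lborel))"

interpretation lborel_prod: product_sigma_finite "\<lambda>_::nat. lborel :: real measure"
  by standard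

text \<open>A box gains one factor \<open>s\<close> per coordinate, and boxes determine the product
  measure.\<close>

lemma PiM_lborel_scale:
  assumes "s > 0"
  shows "PiM {..<n} (\<lambda>_. lborel) = density (distr (PiM {..<n} (\<lambda>_. lborel)) (PiM {..<n} (\<lambda>_. lborel)) (scale_config n s)) (\<lambda>_. ennreal (s ^ n))"
    (is "_ = ?R")
proof (rule lborel_prod.PiM_eqI[symmetric])
  fix A :: "nat \<Rightarrow> real set" assume A: "\<And>i. i \<in> {..<n} \<Longrightarrow> A i \<in> sets lborel"
  have m: "scale_config n s \<in> measurable (PiM {..<n} (\<lambda>_. lborel)) (PiM {..<n} (\<lambda>_. lborel))"
    using measurable_scale_config1[of n s] by (simp cong: measurable_cong_sets add: sets_PiM_lborel_config)
  have A': "Pi\<^sub>E {..<n} A \<in> sets (PiM {..<n} (\<lambda>_. lborel))"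
    using A by (intro sets_PiM_I_finite) auto
  have pre: "scale_config n s -` Pi\<^sub>E {..<n} A \<inter> space (PiM {..<n} (\<lambda>_. lborel)) = Pi\<^sub>E {..<n} (\<lambda>i. (\<lambda>t. s * t) -` A i)"
    by (auto simp: scale_config_def space_PiM PiE_def extensional_def Pi_iff)
  have A2: "(\<lambda>t. s * t) -` A i \<in> sets lborel" if "i < n" for i
    using A[of i] that by (auto intro!: measurable_sets_borel[of "\<lambda>t. s * t"])
  have e: "emeasure lborel (A i) = ennreal s * emeasure lborel ((\<lambda>t. s * t) -` A i)" if "i < n" for i
  proof -
    have "emeasure lborel (A i) = (\<integral>\<^sup>+t. indicator (A i) t \<partial>lborel)" using A that by simp
    also have "\<dots> = ennreal \<bar>s\<bar> * (\<integral>\<^sup>+t. indicator (A i) (0 + s * t) \<partial>lborel)"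
      using assms A that by (intro nn_integral_real_affine) auto
    also have "(\<integral>\<^sup>+t. indicator (A i) (0 + s * t) \<partial>lborel) = (\<integral>\<^sup>+t. indicator ((\<lambda>t. s * t) -` A i) t \<partial>lborel)"
      by (intro nn_integral_cong) (auto simp: indicator_def)
    also have "\<dots> = emeasure lborel ((\<lambda>t. s * t) -` A i)" using A2[OF that] by (rule nn_integral_indicator)
    finally show ?thesis using assms by simp
  qed
  have "emeasure ?R (Pi\<^sub>E {..<n} A) = ennreal (s ^ n) * (\<Prod>i<n. emeasure lborel ((\<lambda>t. s * t) -` A i))"
  proof -
    have "emeasure (PiM {..<n} (\<lambda>_. lborel)) (\<Pi>\<^sub>E i\<in>{..<n}. (\<lambda>t. s * t) -` A i) = (\<Prod>i<n. emeasure lborel ((\<lambda>t. s * t) -` A i))"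
      using A2 by (intro lborel_prod.emeasure_PiM) auto
    then show ?thesis
      using A' m by (subst emeasure_density_const) (simp_all add: emeasure_distr pre)
  qed
  also have "\<dots> = (\<Prod>i<n. ennreal s * emeasure lborel ((\<lambda>t. s * t) -` A i))"
    using assms by (simp add: prod.distrib ennreal_power)
  also have "\<dots> = (\<Prod>i<n. emeasure lborel (A i))"
    by (intro prod.cong) (auto simp: e)
  finally show "emeasure ?R (Pi\<^sub>E {..<n} A) = (\<Prod>i<n. emeasure lborel (A i))" .
qed simp_all

lemma nn_integral_PiM_lborel_scale:
  assumes "s > 0" and [measurable]: "\<phi> \<in> borel_measurable (config_space n)"
  shows "(\<integral>\<^sup>+y. \<phi> y \<partial>PiM {..<n} (\<lambda>_. lborel)) = ennreal (s ^ n) * (\<integral>\<^sup>+y. \<phi> (scale_config n s y) \<partial>PiM {..<n} (\<lambda>_. lborel))"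
proof -
  show ?thesis
    by (subst PiM_lborel_scale[OF assms(1)])
      (simp add: nn_integral_density nn_integral_distr nn_integral_cmult)
qed

lemma simplex_param_scale:
  assumes "N \<ge> 1" "y \<in> space (config_space (N - 1))"
  shows "simplex_param (c * E) N (scale_config (N - 1) c y) = scale_config N c (simplex_param E N y)"
  using assms by (auto simp: simplex_param_def scale_config_def fun_eq_iff algebra_simps sum_distrib_left)

text \<open>The density is homogeneous of degree \<open>N * (\<gamma> - 1)\<close> and the
  \<open>N - 1\<close> free coordinates contribute \<open>c ^ (N - 1)\<close>. The exponents add up
  to \<open>N * \<gamma> - 1\<close>, the one in the Gamma density of parameter
  \<open>N * \<gamma>\<close>. Working before normalisation matters: that the total mass is positive
  and finite is only deduced from this law and the polar formula.\<close>

lemma simplex_int_scale: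
  assumes N: "N \<ge> 1" and E: "c > 0" and [measurable]: "\<phi> \<in> borel_measurable (config_space N)"
  shows "simplex_int \<gamma> (c * E) N \<phi> = ennreal (c powr (real N * \<gamma> - 1)) * simplex_int \<gamma> E N (\<lambda>x. \<phi> (scale_config N c x))"
proof -
  note [measurable] = measurable_simplex_param[OF N] measurable_cond_weight[OF N]
  have w: "cond_weight \<gamma> (c * E) N (scale_config (N - 1) c y) = c powr (real N * (\<gamma> - 1)) * cond_weight \<gamma> E N y"
    if "y \<in> space (config_space (N - 1))" for y
  proof -
    have if_mult_zero: "(if b then u * v else 0) = u * (if b then v else 0)" for b and u v :: real
      by simp
    have "(\<forall>i<N. 0 < scale_config N c x i) \<longleftrightarrow> (\<forall>i<N. 0 < x i)" for x
      using E by (auto simp: scale_config_def zero_less_mult_iff)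
    then have if1: "(if \<forall>i<N. 0 < scale_config N c x i then u else 0) = (if \<forall>i<N. 0 < x i then u else 0)" for x and u :: real
      by simp
    have pr: "(\<Prod>i<N. scale_config N c x i powr (\<gamma> - 1)) = c powr (real N * (\<gamma> - 1)) * (\<Prod>i<N. x i powr (\<gamma> - 1))" for x
      using E by (simp add: scale_config_def powr_mult prod.distrib powr_power mult.commute)
    show ?thesis
      unfolding cond_weight_def Let_def simplex_param_scale[OF N that] if1 pr by (rule if_mult_zero)
  qed
  have p: "c ^ (N - 1) * c powr (real N * (\<gamma> - 1)) = c powr (real N * \<gamma> - 1)"
    using E N by (simp add: powr_realpow[symmetric] powr_add[symmetric] of_nat_diff algebra_simps)
  have sp: "space (PiM {..<N - 1} (\<lambda>_. lborel)) = space (config_space (N - 1))"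
    by (rule sets_eq_imp_space_eq) (rule sets_PiM_lborel_config)
  have "simplex_int \<gamma> (c * E) N \<phi> = ennreal (c ^ (N - 1)) *
     (\<integral>\<^sup>+y. \<phi> (simplex_param (c * E) N (scale_config (N - 1) c y)) * ennreal (cond_weight \<gamma> (c * E) N (scale_config (N - 1) c y)) \<partial>PiM {..<N - 1} (\<lambda>_. lborel))"
    unfolding simplex_int_def by (rule nn_integral_PiM_lborel_scale[OF E]) measurable
  also have "(\<integral>\<^sup>+y. \<phi> (simplex_param (c * E) N (scale_config (N - 1) c y)) * ennreal (cond_weight \<gamma> (c * E) N (scale_config (N - 1) c y)) \<partial>PiM {..<N - 1} (\<lambda>_. lborel))
    = (\<integral>\<^sup>+y. ennreal (c powr (real N * (\<gamma> - 1))) * (\<phi> (scale_config N c (simplex_param E N y)) * ennreal (cond_weight \<gamma> E N y)) \<partial>PiM {..<N - 1} (\<lambda>_. lborel))"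
  proof (rule nn_integral_cong)
    fix y :: "nat \<Rightarrow> real" assume "y \<in> space (PiM {..<N - 1} (\<lambda>_. lborel))"
    then have y: "y \<in> space (config_space (N - 1))" by (simp only: sp)
    show "\<phi> (simplex_param (c * E) N (scale_config (N - 1) c y)) * ennreal (cond_weight \<gamma> (c * E) N (scale_config (N - 1) c y))
      = ennreal (c powr (real N * (\<gamma> - 1))) * (\<phi> (scale_config N c (simplex_param E N y)) * ennreal (cond_weight \<gamma> E N y))"
      unfolding w[OF y] simplex_param_scale[OF N y] by (simp add: ennreal_mult mult_ac)
  qed
  also have "\<dots> = ennreal (c powr (real N * (\<gamma> - 1))) * simplex_int \<gamma> E N (\<lambda>x. \<phi> (scale_config N c x))"
    unfolding simplex_int_def by (rule nn_integral_cmult) measurable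
  moreover have "ennreal (c ^ (N - 1)) * ennreal (c powr (real N * (\<gamma> - 1))) = ennreal (c powr (real N * \<gamma> - 1))"
    using E by (simp only: p[symmetric]) (simp add: ennreal_mult)
  ultimately show ?thesis
    by (simp only: mult.assoc[symmetric])
qed

section \<open>Polar decomposition of the product of Gamma laws\<close>

lemma PiM_gamma_law:
  fixes N :: nat
  assumes "\<gamma> > 0"
  shows "PiM {..<N} (\<lambda>_. gamma_law \<gamma>) = density (PiM {..<N} (\<lambda>_. lborel)) (\<lambda>x. \<Prod>i<N. ennreal (gamma_dens \<gamma> (x i) / Gamma \<gamma>))"
    (is "_ = ?R")
proof -
  interpret g: product_sigma_finite "\<lambda>_::nat. gamma_law \<gamma>"
    using prob_space_gamma_law[OF assms] by (simp add: product_sigma_finite_def prob_space_imp_sigma_finite)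
  have "?R = PiM {..<N} (\<lambda>_. gamma_law \<gamma>)"
  proof (rule g.PiM_eqI)
    show "sets ?R = sets (PiM {..<N} (\<lambda>_. gamma_law \<gamma>))"
      by (simp add: sets_PiM_lborel_config sets_PiM_gamma_config)
    fix A :: "nat \<Rightarrow> real set" assume A: "\<And>i. i \<in> {..<N} \<Longrightarrow> A i \<in> sets (gamma_law \<gamma>)"
    have [measurable]: "(\<lambda>x. \<Prod>i<N. ennreal (gamma_dens \<gamma> (x i) / Gamma \<gamma>)) \<in> borel_measurable (PiM {..<N} (\<lambda>_. lborel))"
      by measurable
    have "emeasure ?R (Pi\<^sub>E {..<N} A) = (\<integral>\<^sup>+x. (\<Prod>i<N. ennreal (gamma_dens \<gamma> (x i) / Gamma \<gamma>)) * indicator (Pi\<^sub>E {..<N} A) x \<partial>PiM {..<N} (\<lambda>_. lborel))"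
      using A by (intro emeasure_density) (auto intro!: sets_PiM_I_finite)
    also have "\<dots> = (\<integral>\<^sup>+x. (\<Prod>i<N. ennreal (gamma_dens \<gamma> (x i) / Gamma \<gamma>) * indicator (A i) (x i)) \<partial>PiM {..<N} (\<lambda>_. lborel))"
    proof (rule nn_integral_cong)
      fix x assume "x \<in> space (PiM {..<N} (\<lambda>_. lborel :: real measure))"
      then have "indicator (Pi\<^sub>E {..<N} A) x = (\<Prod>i<N. indicator (A i) (x i) :: ennreal)"
        by (auto simp: indicator_def space_PiM PiE_def Pi_def)
      then show "(\<Prod>i<N. ennreal (gamma_dens \<gamma> (x i) / Gamma \<gamma>)) * indicator (Pi\<^sub>E {..<N} A) x = (\<Prod>i<N. ennreal (gamma_dens \<gamma> (x i) / Gamma \<gamma>) * indicator (A i) (x i))"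
        by (simp add: prod.distrib)
    qed
    also have "\<dots> = (\<Prod>i<N. \<integral>\<^sup>+t. ennreal (gamma_dens \<gamma> t / Gamma \<gamma>) * indicator (A i) t \<partial>lborel)"
      using A by (intro lborel_prod.product_nn_integral_prod) auto
    also have "\<dots> = (\<Prod>i<N. emeasure (gamma_law \<gamma>) (A i))"
      using A by (intro prod.cong) (auto simp: gamma_law_def emeasure_density)
    finally show "emeasure ?R (Pi\<^sub>E {..<N} A) = (\<Prod>i<N. emeasure (gamma_law \<gamma>) (A i))" .
  qed simp
  then show ?thesis by simp
qed

lemma gamma_dens_prod_simplex:
  assumes N: "N \<ge> 1"
  shows "(\<Prod>i<N. gamma_dens \<gamma> (simplex_param E N y i)) = cond_weight \<gamma> E N y * exp (- (real N * E))"
proof (cases "\<forall>i<N. 0 < simplex_param E N y i")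
  case True
  then have "(\<Prod>i<N. gamma_dens \<gamma> (simplex_param E N y i)) = (\<Prod>i<N. simplex_param E N y i powr (\<gamma> - 1) * exp (- simplex_param E N y i))"
    by (intro prod.cong) (auto simp: gamma_dens_def exp_minus divide_inverse less_imp_le)
  also have "\<dots> = cond_weight \<gamma> E N y * exp (\<Sum>i<N. - simplex_param E N y i)"
    using True by (simp add: prod.distrib cond_weight_def Let_def exp_sum)
  finally show ?thesis by (simp add: sum_negf sum_simplex_param[OF N])
next
  case False
  then obtain i where i: "i < N" "simplex_param E N y i \<le> 0" by (auto simp: not_less)
  \<comment> \<open>At the boundary value \<open>0\<close> both sides agree because
    \<open>0 powr (\<gamma> - 1)\<close> is \<open>0\<close> for every exponent.\<close>
  then have "gamma_dens \<gamma> (simplex_param E N y i) = 0"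
    by (cases "simplex_param E N y i = 0") (auto simp: gamma_dens_def)
  then have "(\<Prod>i<N. gamma_dens \<gamma> (simplex_param E N y i)) = 0"
    using i by (auto intro!: prod_zero)
  moreover have "cond_weight \<gamma> E N y = 0"
    using False by (simp only: cond_weight_def Let_def if_False)
  ultimately show ?thesis by simp
qed

lemma cond_weight_nonpos: "N \<ge> 1 \<Longrightarrow> E \<le> 0 \<Longrightarrow> cond_weight \<gamma> E N y = 0"
proof (rule ccontr)
  assume N: "N \<ge> 1" and E: "E \<le> 0" and c: "cond_weight \<gamma> E N y \<noteq> 0"
  then have "\<forall>i<N. 0 < simplex_param E N y i" by (auto simp: cond_weight_def Let_def split: if_splits)
  then have "0 < (\<Sum>i<N. simplex_param E N y i)" using N by (intro sum_pos) (auto simp: lessThan_empty_iff)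
  then show False using sum_simplex_param[OF N, of E y] E N by (simp add: zero_less_mult_iff)
qed

text \<open>The substitution \<open>x\<^sub>N\<^sub>-\<^sub>1 = s - \<Sum> y\<close> turns the product density into an integral over levels of the sum.\<close>
lemma nn_integral_PiM_gamma_polar:
  assumes \<gamma>: "\<gamma> > 0" and N: "N \<ge> 1" and [measurable]: "\<phi> \<in> borel_measurable (config_space N)"
  shows "ennreal (Gamma \<gamma> ^ N) * (\<integral>\<^sup>+x. \<phi> x \<partial>PiM {..<N} (\<lambda>_. gamma_law \<gamma>)) =
    (\<integral>\<^sup>+s. ennreal (gamma_dens (real N * \<gamma>) s) * simplex_int \<gamma> (1 / real N) N (\<lambda>x. \<phi> (scale_config N s x)) \<partial>lborel)"
proof -
  obtain n where n: "N = Suc n" using N by (cases N) auto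
  have G: "Gamma \<gamma> > 0" using \<gamma> by simp
  let ?g = "\<lambda>x. ennreal (\<Prod>i<N. gamma_dens \<gamma> (x i))"
  have [measurable]: "?g \<in> borel_measurable (config_space N)" by measurable
  have "(\<integral>\<^sup>+x. \<phi> x \<partial>PiM {..<N} (\<lambda>_. gamma_law \<gamma>)) =
     (\<integral>\<^sup>+x. (\<Prod>i<N. ennreal (gamma_dens \<gamma> (x i) / Gamma \<gamma>)) * \<phi> x \<partial>PiM {..<N} (\<lambda>_. lborel))"
    unfolding PiM_gamma_law[OF \<gamma>] by (rule nn_integral_density) measurable
  then have "ennreal (Gamma \<gamma> ^ N) * (\<integral>\<^sup>+x. \<phi> x \<partial>PiM {..<N} (\<lambda>_. gamma_law \<gamma>)) =
     (\<integral>\<^sup>+x. ennreal (Gamma \<gamma> ^ N) * ((\<Prod>i<N. ennreal (gamma_dens \<gamma> (x i) / Gamma \<gamma>)) * \<phi> x) \<partial>PiM {..<N} (\<lambda>_. lborel))"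
    by (simp add: nn_integral_cmult)
  also have "\<dots> = (\<integral>\<^sup>+x. ?g x * \<phi> x \<partial>PiM {..<N} (\<lambda>_. lborel))"
  proof (rule nn_integral_cong)
    fix x :: "nat \<Rightarrow> real"
    have "ennreal (Gamma \<gamma> ^ N) * (\<Prod>i<N. ennreal (gamma_dens \<gamma> (x i) / Gamma \<gamma>)) = ?g x"
      using G by (simp add: prod_ennreal ennreal_mult[symmetric] prod_nonneg prod_dividef)
    then show "ennreal (Gamma \<gamma> ^ N) * ((\<Prod>i<N. ennreal (gamma_dens \<gamma> (x i) / Gamma \<gamma>)) * \<phi> x) = ?g x * \<phi> x"
      by (simp add: mult.assoc[symmetric])
  qed
  also have "\<dots> = (\<integral>\<^sup>+y. (\<integral>\<^sup>+t. ?g (y(n := t)) * \<phi> (y(n := t)) \<partial>lborel) \<partial>PiM {..<n} (\<lambda>_. lborel))"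
  proof -
    have m: "(\<lambda>x. ?g x * \<phi> x) \<in> borel_measurable (PiM (insert n {..<n}) (\<lambda>_. lborel))"
    proof -
      have "insert n {..<n} = {..<N}" using n by auto
      then show ?thesis by (simp only:) measurable
    qed
    show ?thesis
      using lborel_prod.product_nn_integral_insert[OF _ _ m] by (simp add: n lessThan_Suc)
  qed
  also have "\<dots> = (\<integral>\<^sup>+y. (\<integral>\<^sup>+s. ?g (simplex_param (s / real N) N y) * \<phi> (simplex_param (s / real N) N y) \<partial>lborel) \<partial>PiM {..<n} (\<lambda>_. lborel))"
  proof (rule nn_integral_cong)
    fix y :: "nat \<Rightarrow> real" assume y: "y \<in> space (PiM {..<n} (\<lambda>_. lborel))"
    have eq: "y(n := - (\<Sum>k<n. y k) + 1 * s) = simplex_param (s / real N) N y" for s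
      using y by (auto simp: simplex_param_def n fun_eq_iff space_PiM PiE_def extensional_def)
    have [measurable]: "(\<lambda>t. y(n := t)) \<in> measurable borel (config_space N)"
      using y by (intro measurable_configI) (auto simp: n space_PiM PiE_def extensional_def less_Suc_eq)
    have [measurable]: "(\<lambda>t. ?g (y(n := t)) * \<phi> (y(n := t))) \<in> borel_measurable borel"
      using measurable_compose[OF \<open>(\<lambda>t. y(n := t)) \<in> measurable borel (config_space N)\<close>, of "\<lambda>x. ?g x * \<phi> x" borel]
      by simp
    have "(\<integral>\<^sup>+t. ?g (y(n := t)) * \<phi> (y(n := t)) \<partial>lborel) = ennreal \<bar>1\<bar> * (\<integral>\<^sup>+s. ?g (y(n := - (\<Sum>k<n. y k) + 1 * s)) * \<phi> (y(n := - (\<Sum>k<n. y k) + 1 * s)) \<partial>lborel)"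
      by (rule nn_integral_real_affine) (fact, simp)
    then show "(\<integral>\<^sup>+t. ?g (y(n := t)) * \<phi> (y(n := t)) \<partial>lborel) = (\<integral>\<^sup>+s. ?g (simplex_param (s / real N) N y) * \<phi> (simplex_param (s / real N) N y) \<partial>lborel)"
      unfolding eq by simp
  qed
  also have "\<dots> = (\<integral>\<^sup>+s. (\<integral>\<^sup>+y. ?g (simplex_param (s / real N) N y) * \<phi> (simplex_param (s / real N) N y) \<partial>PiM {..<n} (\<lambda>_. lborel)) \<partial>lborel)"
  proof -
    let ?F = "\<lambda>s y. ?g (simplex_param (s / real N) N y) * \<phi> (simplex_param (s / real N) N y)"
    interpret f: finite_product_sigma_finite "\<lambda>_::nat. lborel :: real measure" "{..<n}" by standard simp
    interpret p: pair_sigma_finite lborel "PiM {..<n} (\<lambda>_. lborel :: real measure)"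
      by (rule pair_sigma_finite.intro[OF lborel.sigma_finite_measure_axioms f.sigma_finite_measure_axioms])
    have "(\<lambda>(s, y). (s / real N, y)) \<in> measurable (lborel \<Otimes>\<^sub>M PiM {..<n} (\<lambda>_. lborel)) (borel \<Otimes>\<^sub>M config_space n)"
      by measurable
    from measurable_compose[OF this measurable_simplex_param_pair[OF N, unfolded n diff_Suc_1, folded n]]
    have "(\<lambda>(s, y). simplex_param (s / real N) N y) \<in> measurable (lborel \<Otimes>\<^sub>M PiM {..<n} (\<lambda>_. lborel)) (config_space N)"
      by (simp add: split_beta')
    from measurable_compose[OF this, of "\<lambda>x. ?g x * \<phi> x" borel]
    have "(\<lambda>(s, y). ?F s y) \<in> borel_measurable (lborel \<Otimes>\<^sub>M PiM {..<n} (\<lambda>_. lborel))"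
      by (simp add: split_beta')
    from p.Fubini'[OF this] show ?thesis .
  qed
  also have "\<dots> = (\<integral>\<^sup>+s. ennreal (exp (- s)) * simplex_int \<gamma> (s / real N) N \<phi> \<partial>lborel)"
  proof (rule nn_integral_cong)
    fix s :: real
    note [measurable] = measurable_simplex_param[OF N] measurable_cond_weight[OF N]
    have "ennreal (exp (- s)) * simplex_int \<gamma> (s / real N) N \<phi> =
      (\<integral>\<^sup>+y. ennreal (exp (- s)) * (\<phi> (simplex_param (s / real N) N y) * ennreal (cond_weight \<gamma> (s / real N) N y)) \<partial>PiM {..<N - 1} (\<lambda>_. lborel))"
      unfolding simplex_int_def by (rule nn_integral_cmult[symmetric]) measurable
    also have "\<dots> = (\<integral>\<^sup>+y. ?g (simplex_param (s / real N) N y) * \<phi> (simplex_param (s / real N) N y) \<partial>PiM {..<n} (\<lambda>_. lborel))"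
      using N by (simp add: gamma_dens_prod_simplex n ennreal_mult mult_ac del: prod.lessThan_Suc)
    finally show "(\<integral>\<^sup>+y. ?g (simplex_param (s / real N) N y) * \<phi> (simplex_param (s / real N) N y) \<partial>PiM {..<n} (\<lambda>_. lborel)) = ennreal (exp (- s)) * simplex_int \<gamma> (s / real N) N \<phi>" ..
  qed
  also have "\<dots> = (\<integral>\<^sup>+s. ennreal (gamma_dens (real N * \<gamma>) s) * simplex_int \<gamma> (1 / real N) N (\<lambda>x. \<phi> (scale_config N s x)) \<partial>lborel)"
  proof (rule nn_integral_cong)
    fix s :: real
    show "ennreal (exp (- s)) * simplex_int \<gamma> (s / real N) N \<phi> = ennreal (gamma_dens (real N * \<gamma>) s) * simplex_int \<gamma> (1 / real N) N (\<lambda>x. \<phi> (scale_config N s x))"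
    proof (cases "s > 0")
      case True
      \<comment> \<open>The level of sum \<open>s\<close> is the dilate by \<open>s\<close> of the
        level of sum one. The power of \<open>s\<close> gained by the dilation, times
        \<open>exp (- s)\<close>, is the Gamma density of parameter
        \<open>N * \<gamma>\<close>.\<close>
      show ?thesis using simplex_int_scale[OF N True, of \<phi> \<gamma> "1 / real N"] True
        by (simp add: mult.assoc[symmetric] ennreal_mult[symmetric] gamma_dens_def exp_minus divide_inverse mult_ac)
    next
      case False
      then have "gamma_dens (real N * \<gamma>) s = 0" by (cases "s = 0") (auto simp: gamma_dens_def)
      moreover have "simplex_int \<gamma> (s / real N) N \<phi> = 0"
        using False by (simp add: simplex_int_def cond_weight_nonpos[OF N] divide_nonpos_nonneg)
      ultimately show ?thesis by simp
    qed
  qed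
  finally show ?thesis .
qed

section \<open>Normalisation of the conditional law\<close>

lemma cond_norm_eq: "cond_norm \<gamma> E N = simplex_int \<gamma> E N (\<lambda>_. 1)"
  by (simp add: cond_norm_def simplex_int_def)

lemma prob_space_PiM_gamma: "\<gamma> > 0 \<Longrightarrow> prob_space (PiM I (\<lambda>_. gamma_law \<gamma>))"
  by (intro prob_space_PiM prob_space_gamma_law)

text \<open>This is the Dirichlet integral, read off from the polar formula at
  \<open>\<phi> = 1\<close>, where the Gamma product has mass one. For \<open>N = 2\<close> it is
  the Beta function.\<close>

lemma cond_norm_unit:
  assumes \<gamma>: "\<gamma> > 0" and N: "N \<ge> 1"
  shows "cond_norm \<gamma> (1 / real N) N = ennreal (Gamma \<gamma> ^ N / Gamma (real N * \<gamma>))"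
proof -
  interpret p: prob_space "PiM {..<N} (\<lambda>_. gamma_law \<gamma>)" by (rule prob_space_PiM_gamma[OF \<gamma>])
  have G: "Gamma (real N * \<gamma>) > 0" "Gamma \<gamma> > 0" using \<gamma> N by simp_all
  have "ennreal (Gamma \<gamma> ^ N) = (\<integral>\<^sup>+s. ennreal (gamma_dens (real N * \<gamma>) s) * cond_norm \<gamma> (1 / real N) N \<partial>lborel)"
    using nn_integral_PiM_gamma_polar[OF \<gamma> N, of "\<lambda>_. 1"] by (simp add: p.emeasure_space_1 cond_norm_eq)
  also have "\<dots> = ennreal (Gamma (real N * \<gamma>)) * cond_norm \<gamma> (1 / real N) N"
    using \<gamma> N by (simp add: nn_integral_multc nn_integral_gamma_dens)
  finally have eq: "ennreal (Gamma \<gamma> ^ N) = ennreal (Gamma (real N * \<gamma>)) * cond_norm \<gamma> (1 / real N) N" .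
  then have "cond_norm \<gamma> (1 / real N) N \<noteq> \<top>"
    using G by (auto simp: ennreal_mult_top)
  then obtain c where c: "cond_norm \<gamma> (1 / real N) N = ennreal c" "c \<ge> 0" by (cases "cond_norm \<gamma> (1 / real N) N") auto
  have "Gamma \<gamma> ^ N = Gamma (real N * \<gamma>) * c"
    using eq G unfolding c(1) by (simp add: ennreal_mult[symmetric] c(2))
  then show ?thesis using G by (simp add: c(1) field_simps)
qed

lemma cond_norm_pos_finite:
  assumes \<gamma>: "\<gamma> > 0" and N: "N \<ge> 1" and E: "E > 0"
  shows "0 < cond_norm \<gamma> E N" "cond_norm \<gamma> E N < \<top>"
proof -
  have c: "real N * E > 0" and e: "real N * E * (1 / real N) = E" using N E by auto
  have G: "Gamma \<gamma> ^ N / Gamma (real N * \<gamma>) > 0" using \<gamma> N by simp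
  have eq: "cond_norm \<gamma> E N = ennreal ((real N * E) powr (real N * \<gamma> - 1)) * ennreal (Gamma \<gamma> ^ N / Gamma (real N * \<gamma>))"
    using simplex_int_scale[OF N c, of "\<lambda>_. 1" \<gamma> "1 / real N"] unfolding e cond_norm_unit[OF \<gamma> N, symmetric] cond_norm_eq by simp
  show "0 < cond_norm \<gamma> E N" "cond_norm \<gamma> E N < \<top>"
    unfolding eq using G c N E by (simp_all add: ennreal_zero_less_mult_iff ennreal_mult_less_top)
qed

lemma sets_nu_cond [simp, measurable_cong]: "sets (nu_cond \<gamma> E N) = sets (config_space N)"
  by (simp add: nu_cond_def)

lemma space_nu_cond [simp]: "space (nu_cond \<gamma> E N) = space (config_space N)"
  by (simp add: nu_cond_def)

lemma nn_integral_nu_cond: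
  assumes N: "N \<ge> 1" and [measurable]: "\<phi> \<in> borel_measurable (config_space N)"
  shows "(\<integral>\<^sup>+x. \<phi> x \<partial>nu_cond \<gamma> E N) = simplex_int \<gamma> E N \<phi> / cond_norm \<gamma> E N"
proof -
  note [measurable] = measurable_simplex_param[OF N] measurable_cond_weight[OF N]
  let ?D = "density (PiM {..<N - 1} (\<lambda>_. lborel)) (\<lambda>y. ennreal (cond_weight \<gamma> E N y) / cond_norm \<gamma> E N)"
  have "(\<integral>\<^sup>+x. \<phi> x \<partial>nu_cond \<gamma> E N) = (\<integral>\<^sup>+y. \<phi> (simplex_param E N y) \<partial>?D)"
    unfolding nu_cond_def by (rule nn_integral_distr) measurable
  also have "\<dots> = (\<integral>\<^sup>+y. ennreal (cond_weight \<gamma> E N y) / cond_norm \<gamma> E N * \<phi> (simplex_param E N y) \<partial>PiM {..<N - 1} (\<lambda>_. lborel))"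
    by (rule nn_integral_density) measurable
  also have "\<dots> = (\<integral>\<^sup>+y. \<phi> (simplex_param E N y) * ennreal (cond_weight \<gamma> E N y) / cond_norm \<gamma> E N \<partial>PiM {..<N - 1} (\<lambda>_. lborel))"
    by (simp add: divide_ennreal_def mult_ac)
  also have "\<dots> = simplex_int \<gamma> E N \<phi> / cond_norm \<gamma> E N"
    unfolding simplex_int_def by (rule nn_integral_divide) measurable
  finally show ?thesis .
qed

lemma prob_space_nu_cond:
  assumes "\<gamma> > 0" "N \<ge> 1" "E > 0"
  shows "prob_space (nu_cond \<gamma> E N)"
proof (rule prob_spaceI)
  have "(\<integral>\<^sup>+x. 1 \<partial>nu_cond \<gamma> E N) = cond_norm \<gamma> E N / cond_norm \<gamma> E N"
    using nn_integral_nu_cond[OF assms(2), of "\<lambda>_. 1"] by (simp add: cond_norm_eq)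
  then show "emeasure (nu_cond \<gamma> E N) (space (nu_cond \<gamma> E N)) = 1"
    using cond_norm_pos_finite[OF assms] by simp
qed

text \<open>Integral and normalisation gain the same power of \<open>c\<close>, which
  cancels.\<close>

lemma nn_integral_nu_cond_scale:
  assumes \<gamma>: "\<gamma> > 0" and N: "N \<ge> 1" and E: "E > 0" and c: "c > 0" and m[measurable]: "\<phi> \<in> borel_measurable (config_space N)"
  shows "(\<integral>\<^sup>+x. \<phi> x \<partial>nu_cond \<gamma> (c * E) N) = (\<integral>\<^sup>+x. \<phi> (scale_config N c x) \<partial>nu_cond \<gamma> E N)"
proof -
  have "cond_norm \<gamma> (c * E) N = ennreal (c powr (real N * \<gamma> - 1)) * cond_norm \<gamma> E N"
    unfolding cond_norm_eq using simplex_int_scale[OF N c, of "\<lambda>_. 1"] by simp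
  then have "(\<integral>\<^sup>+x. \<phi> x \<partial>nu_cond \<gamma> (c * E) N) =
      simplex_int \<gamma> E N (\<lambda>x. \<phi> (scale_config N c x)) * ennreal (c powr (real N * \<gamma> - 1)) / (cond_norm \<gamma> E N * ennreal (c powr (real N * \<gamma> - 1)))"
    unfolding nn_integral_nu_cond[OF N m] simplex_int_scale[OF N c m] by (simp only: mult.commute)
  also have "\<dots> = simplex_int \<gamma> E N (\<lambda>x. \<phi> (scale_config N c x)) / cond_norm \<gamma> E N"
    using c by (intro divide_mult_eq) auto
  finally show ?thesis by (simp add: nn_integral_nu_cond[OF N])
qed

lemma AE_nu_cond_simplex:
  assumes N: "N \<ge> 1"
  shows "AE x in nu_cond \<gamma> E N. (\<forall>i<N. 0 < x i) \<and> (\<Sum>i<N. x i) = real N * E"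
proof -
  note [measurable] = measurable_simplex_param[OF N] measurable_cond_weight[OF N]
  let ?w = "\<lambda>y. ennreal (cond_weight \<gamma> E N y) / cond_norm \<gamma> E N"
  let ?P = "\<lambda>x. (\<forall>i<N. 0 < x i) \<and> (\<Sum>i<N. x i) = real N * E"
  have 1: "?w \<in> borel_measurable (PiM {..<N - 1} (\<lambda>_. lborel))" by measurable
  have "AE y in density (PiM {..<N - 1} (\<lambda>_. lborel)) ?w. ?P (simplex_param E N y)"
    unfolding AE_density[OF 1] by (rule AE_I2) (auto simp: sum_simplex_param[OF N] cond_weight_def Let_def)
  moreover have "simplex_param E N \<in> measurable (density (PiM {..<N - 1} (\<lambda>_. lborel)) ?w) (config_space N)"
    by measurable
  moreover have "{x \<in> space (config_space N). ?P x} \<in> sets (config_space N)" by measurable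
  ultimately show ?thesis
    unfolding nu_cond_def by (subst AE_distr_iff)
qed

section \<open>Direction and sum of a Gamma vector\<close>

lemma measurable_scale_config' [measurable]:
  assumes "f \<in> borel_measurable M" "g \<in> measurable M (config_space N)"
  shows "(\<lambda>x. scale_config N (f x) (g x)) \<in> measurable M (config_space N)"
  using measurable_compose[OF measurable_Pair[OF assms] measurable_scale_config] by simp

text \<open>The polar formula with both factors turned into probability laws; the Dirichlet integral
  is exactly the constant that makes this possible.\<close>

lemma nn_integral_PiM_gamma:
  assumes \<gamma>: "\<gamma> > 0" and N: "N \<ge> 1" and [measurable]: "\<phi> \<in> borel_measurable (config_space N)"
  shows "(\<integral>\<^sup>+x. \<phi> x \<partial>PiM {..<N} (\<lambda>_. gamma_law \<gamma>)) =
    (\<integral>\<^sup>+s. (\<integral>\<^sup>+x. \<phi> (scale_config N s x) \<partial>nu_cond \<gamma> (1 / real N) N) \<partial>gamma_law (real N * \<gamma>))"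
proof -
  interpret nu: prob_space "nu_cond \<gamma> (1 / real N) N" using \<gamma> N by (intro prob_space_nu_cond) auto
  let ?cn = "cond_norm \<gamma> (1 / real N) N"
  have cn: "0 < ?cn" "?cn < \<top>" using \<gamma> N by (intro cond_norm_pos_finite; simp)+
  have G: "Gamma \<gamma> > 0" "Gamma \<gamma> ^ N > 0" "Gamma (real N * \<gamma>) > 0" using \<gamma> N by simp_all
  define U where "U s = (\<integral>\<^sup>+x. \<phi> (scale_config N s x) \<partial>nu_cond \<gamma> (1 / real N) N)" for s
  have [measurable]: "U \<in> borel_measurable borel"
    unfolding U_def[abs_def] by measurable
  have si: "simplex_int \<gamma> (1 / real N) N (\<lambda>x. \<phi> (scale_config N s x)) = ?cn * U s" for s
    using cn by (simp add: U_def nn_integral_nu_cond[OF N] ennreal_times_divide mult.commute[of ?cn] mult_divide_eq_ennreal)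
  have "ennreal (Gamma \<gamma> ^ N) * (\<integral>\<^sup>+x. \<phi> x \<partial>PiM {..<N} (\<lambda>_. gamma_law \<gamma>)) =
     (\<integral>\<^sup>+s. ennreal (gamma_dens (real N * \<gamma>) s) * (?cn * U s) \<partial>lborel)"
    using nn_integral_PiM_gamma_polar[OF \<gamma> N assms(3)] by (simp add: si)
  also have "\<dots> = (\<integral>\<^sup>+s. ennreal (Gamma \<gamma> ^ N) * (ennreal (gamma_dens (real N * \<gamma>) s / Gamma (real N * \<gamma>)) * U s) \<partial>lborel)"
  proof (rule nn_integral_cong)
    fix s :: real
    have "ennreal (gamma_dens (real N * \<gamma>) s) * ennreal (Gamma \<gamma> ^ N / Gamma (real N * \<gamma>)) =
      ennreal (Gamma \<gamma> ^ N) * ennreal (gamma_dens (real N * \<gamma>) s / Gamma (real N * \<gamma>))"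
      using G by (simp add: ennreal_mult[symmetric] less_imp_le mult.commute)
    then show "ennreal (gamma_dens (real N * \<gamma>) s) * (?cn * U s) =
      ennreal (Gamma \<gamma> ^ N) * (ennreal (gamma_dens (real N * \<gamma>) s / Gamma (real N * \<gamma>)) * U s)"
      unfolding cond_norm_unit[OF \<gamma> N] by (simp only: mult.assoc[symmetric])
  qed
  also have "\<dots> = ennreal (Gamma \<gamma> ^ N) * (\<integral>\<^sup>+s. U s \<partial>gamma_law (real N * \<gamma>))"
    unfolding gamma_law_def by (simp add: nn_integral_density nn_integral_cmult)
  finally show ?thesis
    using G by (simp add: ennreal_mult_cancel_left U_def)
qed

lemma scale_config_scale [simp]: "scale_config N c (scale_config N d x) = scale_config N (c * d) x"
  by (auto simp: scale_config_def)

lemma sum_scale_config [simp]: "(\<Sum>i<N. scale_config N c x i) = c * (\<Sum>i<N. x i)"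
  by (simp add: scale_config_def sum_distrib_left)

lemma AE_gamma_law_pos: "AE s in gamma_law a. s > 0"
proof -
  have z: "gamma_dens a s / Gamma a = 0" if "\<not> s > 0" for s
    using that by (cases "s = 0") (auto simp: gamma_dens_def)
  have m: "(\<lambda>t. ennreal (gamma_dens a t / Gamma a)) \<in> borel_measurable lborel" by measurable
  show ?thesis
    unfolding gamma_law_def AE_density[OF m]
  proof (rule AE_I2, rule impI, rule ccontr)
    fix s assume "0 < ennreal (gamma_dens a s / Gamma a)" "\<not> s > 0"
    then show False by (simp add: z)
  qed
qed

text \<open>Dividing by the sum cancels the radial variable and leaves the direction, which is then
  dilated to the level \<open>N * E\<close>. This is the bridge by which invariances of independent
  Gamma variables become invariances of \<nu>.\<close>

lemma nn_integral_nu_cond_gamma: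
  assumes \<gamma>: "\<gamma> > 0" and N: "N \<ge> 1" and E: "E > 0" and [measurable]: "\<phi> \<in> borel_measurable (config_space N)"
  shows "(\<integral>\<^sup>+x. \<phi> x \<partial>nu_cond \<gamma> E N) =
    (\<integral>\<^sup>+x. \<phi> (scale_config N (real N * E / (\<Sum>i<N. x i)) x) \<partial>PiM {..<N} (\<lambda>_. gamma_law \<gamma>))"
proof -
  let ?L = "real N * E"
  interpret g: prob_space "gamma_law (real N * \<gamma>)" using \<gamma> N by (intro prob_space_gamma_law) simp
  have L: "?L > 0" using N E by simp
  have "(\<integral>\<^sup>+x. \<phi> (scale_config N (?L / (\<Sum>i<N. x i)) x) \<partial>PiM {..<N} (\<lambda>_. gamma_law \<gamma>)) =
    (\<integral>\<^sup>+s. (\<integral>\<^sup>+x. \<phi> (scale_config N (?L / (s * (\<Sum>i<N. x i)) * s) x) \<partial>nu_cond \<gamma> (1 / real N) N) \<partial>gamma_law (real N * \<gamma>))"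
    by (subst nn_integral_PiM_gamma[OF \<gamma> N]) simp_all
  also have "\<dots> = (\<integral>\<^sup>+s. (\<integral>\<^sup>+x. \<phi> (scale_config N ?L x) \<partial>nu_cond \<gamma> (1 / real N) N) \<partial>gamma_law (real N * \<gamma>))"
  proof (rule nn_integral_cong_AE, rule AE_mp[OF AE_gamma_law_pos], rule AE_I2, rule impI)
    \<comment> \<open>The factors \<open>s\<close> cancel only for \<open>s > 0\<close>, which is
      almost sure; at \<open>s = 0\<close> the quotient would be \<open>0\<close>.\<close>
    fix s :: real assume s: "s > 0"
    show "(\<integral>\<^sup>+x. \<phi> (scale_config N (?L / (s * (\<Sum>i<N. x i)) * s) x) \<partial>nu_cond \<gamma> (1 / real N) N) =
       (\<integral>\<^sup>+x. \<phi> (scale_config N ?L x) \<partial>nu_cond \<gamma> (1 / real N) N)"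
      using AE_nu_cond_simplex[OF N, where \<gamma>=\<gamma> and E="1 / real N"] N s
      by (intro nn_integral_cong_AE) (elim AE_mp, intro AE_I2, auto)
  qed
  also have "\<dots> = (\<integral>\<^sup>+x. \<phi> (scale_config N ?L x) \<partial>nu_cond \<gamma> (1 / real N) N)"
    by (simp add: g.emeasure_space_1[simplified])
  also have "\<dots> = (\<integral>\<^sup>+x. \<phi> x \<partial>nu_cond \<gamma> (?L * (1 / real N)) N)"
    using N L by (intro nn_integral_nu_cond_scale[symmetric] \<gamma>) auto
  also have "?L * (1 / real N) = E" using N by simp
  finally show ?thesis by simp
qed

text \<open>The normalised Gamma vector is independent of its sum.\<close>
lemma nn_integral_PiM_gamma_resample:
  assumes \<gamma>: "\<gamma> > 0" and N: "N \<ge> 1" and [measurable]: "\<phi> \<in> borel_measurable (config_space N)"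
  shows "(\<integral>\<^sup>+x. \<phi> x \<partial>PiM {..<N} (\<lambda>_. gamma_law \<gamma>)) =
    (\<integral>\<^sup>+x. (\<integral>\<^sup>+z. \<phi> (scale_config N (\<Sum>i<N. x i) z) \<partial>nu_cond \<gamma> (1 / real N) N) \<partial>PiM {..<N} (\<lambda>_. gamma_law \<gamma>))"
proof -
  interpret nu: prob_space "nu_cond \<gamma> (1 / real N) N" using \<gamma> N by (intro prob_space_nu_cond) auto
  have "(\<integral>\<^sup>+x. (\<integral>\<^sup>+z. \<phi> (scale_config N (\<Sum>i<N. x i) z) \<partial>nu_cond \<gamma> (1 / real N) N) \<partial>PiM {..<N} (\<lambda>_. gamma_law \<gamma>)) =
    (\<integral>\<^sup>+s. (\<integral>\<^sup>+x. (\<integral>\<^sup>+z. \<phi> (scale_config N (s * (\<Sum>i<N. x i)) z) \<partial>nu_cond \<gamma> (1 / real N) N) \<partial>nu_cond \<gamma> (1 / real N) N) \<partial>gamma_law (real N * \<gamma>))"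
    by (subst nn_integral_PiM_gamma[OF \<gamma> N]) simp_all
  also have "\<dots> = (\<integral>\<^sup>+s. (\<integral>\<^sup>+z. \<phi> (scale_config N s z) \<partial>nu_cond \<gamma> (1 / real N) N) \<partial>gamma_law (real N * \<gamma>))"
  proof (rule nn_integral_cong)
    fix s :: real
    have "(\<integral>\<^sup>+x. (\<integral>\<^sup>+z. \<phi> (scale_config N (s * (\<Sum>i<N. x i)) z) \<partial>nu_cond \<gamma> (1 / real N) N) \<partial>nu_cond \<gamma> (1 / real N) N) =
      (\<integral>\<^sup>+x. (\<integral>\<^sup>+z. \<phi> (scale_config N s z) \<partial>nu_cond \<gamma> (1 / real N) N) \<partial>nu_cond \<gamma> (1 / real N) N)"
      using AE_nu_cond_simplex[OF N, where \<gamma>=\<gamma> and E="1 / real N"] N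
      by (intro nn_integral_cong_AE) (elim AE_mp, intro AE_I2, auto)
    then show "(\<integral>\<^sup>+x. (\<integral>\<^sup>+z. \<phi> (scale_config N (s * (\<Sum>i<N. x i)) z) \<partial>nu_cond \<gamma> (1 / real N) N) \<partial>nu_cond \<gamma> (1 / real N) N) =
      (\<integral>\<^sup>+z. \<phi> (scale_config N s z) \<partial>nu_cond \<gamma> (1 / real N) N)"
      using nu.emeasure_space_1 by simp
  qed
  also have "\<dots> = (\<integral>\<^sup>+x. \<phi> x \<partial>PiM {..<N} (\<lambda>_. gamma_law \<gamma>))"
    by (rule nn_integral_PiM_gamma[OF \<gamma> N, symmetric]) simp
  finally show ?thesis by simp
qed

section \<open>Exchangeability\<close>

lemma permuted_in_config_space:
  assumes "p permutes {..<N}" "x \<in> space (config_space N)"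
  shows "x \<circ> p \<in> space (config_space N)"
  using assms by (auto simp: space_config_space extensional_def permutes_def)

lemma measurable_permuted [measurable]:
  assumes "p permutes {..<N}"
  shows "(\<lambda>x. x \<circ> p) \<in> measurable (config_space N) (config_space N)"
proof (rule measurable_configI)
  fix i assume "i < N"
  then have "p i < N" using permutes_in_image[OF assms, of i] by simp
  then show "(\<lambda>x. (x \<circ> p) i) \<in> borel_measurable (config_space N)" by simp
next
  fix x :: "nat \<Rightarrow> real" and i assume "x \<in> space (config_space N)" "\<not> i < N"
  then show "(x \<circ> p) i = undefined"
    using permuted_in_config_space[OF assms, of x] by (auto simp: space_config_space extensional_def)
qed

text \<open>Independent identically distributed coordinates are exchangeable, and normalising by the
  sum commutes with permuting the sites.\<close>

lemma nn_integral_nu_cond_permute: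
  assumes \<gamma>: "\<gamma> > 0" and N: "N \<ge> 1" and E: "E > 0" and p: "p permutes {..<N}"
    and [measurable]: "\<phi> \<in> borel_measurable (config_space N)"
  shows "(\<integral>\<^sup>+x. \<phi> (x \<circ> p) \<partial>nu_cond \<gamma> E N) = (\<integral>\<^sup>+x. \<phi> x \<partial>nu_cond \<gamma> E N)"
proof -
  note [measurable] = measurable_permuted[OF p]
  let ?P = "PiM {..<N} (\<lambda>_. gamma_law \<gamma>)"
  have "distr ?P ?P (\<lambda>\<omega>. \<lambda>i\<in>{..<N}. \<omega> (p i)) = ?P"
    using p by (intro distr_PiM_reindex prob_space_gamma_law \<gamma>) (auto simp: permutes_inj_on permutes_in_image simp del: lessThan_iff)
  moreover have "distr ?P ?P (\<lambda>\<omega>. \<lambda>i\<in>{..<N}. \<omega> (p i)) = distr ?P ?P (\<lambda>x. x \<circ> p)"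
  proof (rule distr_cong)
    fix x assume "x \<in> space ?P"
    then have "x \<in> space (config_space N)" by (simp add: space_config_space space_PiM PiE_def)
    then have "x \<circ> p \<in> extensional {..<N}" using permuted_in_config_space[OF p] by (simp add: space_config_space)
    then show "(\<lambda>i\<in>{..<N}. x (p i)) = x \<circ> p" by (auto simp: extensional_def fun_eq_iff)
  qed simp_all
  ultimately have P: "distr ?P ?P (\<lambda>x. x \<circ> p) = ?P" by simp
  define \<psi> where "\<psi> x = \<phi> (scale_config N (real N * E / (\<Sum>i<N. x i)) x)" for x
  have [measurable]: "\<psi> \<in> borel_measurable (config_space N)" unfolding \<psi>_def by measurable
  have "(\<Sum>i<N. (x \<circ> p) i) = (\<Sum>i<N. x i)" for x :: "nat \<Rightarrow> real"
    using sum.permute[OF p, of x] by simp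
  moreover have "scale_config N c (x \<circ> p) = scale_config N c x \<circ> p" for c x
    using permutes_in_image[OF p] by (auto simp: scale_config_def fun_eq_iff)
  ultimately have \<psi>: "\<psi> (x \<circ> p) = \<phi> (scale_config N (real N * E / (\<Sum>i<N. x i)) x \<circ> p)" for x
    by (simp only: \<psi>_def)
  have "(\<integral>\<^sup>+x. \<phi> x \<partial>nu_cond \<gamma> E N) = (\<integral>\<^sup>+x. \<psi> x \<partial>?P)"
    unfolding \<psi>_def by (rule nn_integral_nu_cond_gamma[OF \<gamma> N E]) simp
  also have "\<dots> = (\<integral>\<^sup>+x. \<psi> x \<partial>distr ?P ?P (\<lambda>x. x \<circ> p))" by (simp only: P)
  also have "\<dots> = (\<integral>\<^sup>+x. \<psi> (x \<circ> p) \<partial>?P)" by (rule nn_integral_distr) measurable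
  also have "\<dots> = (\<integral>\<^sup>+x. \<phi> (x \<circ> p) \<partial>nu_cond \<gamma> E N)"
    unfolding \<psi> by (rule nn_integral_nu_cond_gamma[OF \<gamma> N E, symmetric]) measurable
  finally show ?thesis ..
qed

section \<open>Resampling blocks of sites\<close>

text \<open>The map \<open>b\<close> lists the sites of the block, and \<open>z\<close> gives
  proportions indexed by the position in that list. The block energy is preserved when
  \<open>z\<close> sums to one, which is almost sure under
  \<open>nu_cond \<gamma> (1 / n) n\<close>.\<close>

definition block_replace :: "nat \<Rightarrow> (nat \<Rightarrow> nat) \<Rightarrow> (nat \<Rightarrow> real) \<Rightarrow> (nat \<Rightarrow> real) \<Rightarrow> nat \<Rightarrow> real" where
  "block_replace n b x z = (\<lambda>i. if i \<in> b ` {..<n} then (\<Sum>k<n. x (b k)) * z (inv_into {..<n} b i) else x i)"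

lemma measurable_block_replace [measurable]:
  assumes b: "inj_on b {..<n}" "b ` {..<n} \<subseteq> {..<N}"
    and f[measurable]: "f \<in> measurable M (config_space N)" and g[measurable]: "g \<in> measurable M (config_space n)"
  shows "(\<lambda>x. block_replace n b (f x) (g x)) \<in> measurable M (config_space N)"
proof (rule measurable_configI)
  fix i assume i: "i < N"
  have [measurable]: "(\<lambda>x. f x (b k)) \<in> borel_measurable M" if "k < n" for k
    using b that by (intro measurable_config_component'[OF f, of "\<lambda>x. x" M, simplified]) auto
  show "(\<lambda>x. block_replace n b (f x) (g x) i) \<in> borel_measurable M"
  proof (cases "i \<in> b ` {..<n}")
    case True
    then have [measurable]: "inv_into {..<n} b i < n" using inv_into_into[of i b "{..<n}"] by auto
    show ?thesis using True by (simp add: block_replace_def) measurable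
  qed (use i in \<open>simp add: block_replace_def\<close>)
next
  fix x i assume x: "x \<in> space M" and i: "\<not> i < N"
  then have "f x i = undefined"
    using measurable_space[OF f x] by (auto simp: space_config_space extensional_def)
  then show "block_replace n b (f x) (g x) i = undefined" using b i by (auto simp: block_replace_def)
qed

lemma block_replace_in [simp]: "inj_on b {..<n} \<Longrightarrow> k < n \<Longrightarrow> block_replace n b x z (b k) = (\<Sum>k<n. x (b k)) * z k"
  by (simp add: block_replace_def)

lemma block_replace_out: "i \<notin> b ` {..<n} \<Longrightarrow> block_replace n b x z i = x i"
  by (simp add: block_replace_def)

lemma block_sum_block_replace:
  assumes "inj_on b {..<n}" "(\<Sum>k<n. z k) = 1"
  shows "(\<Sum>k<n. block_replace n b x z (b k)) = (\<Sum>k<n. x (b k))"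
  using assms by (simp add: sum_distrib_left[symmetric])

lemma sum_block_replace:
  assumes b: "inj_on b {..<n}" "b ` {..<n} \<subseteq> {..<N}" and z: "(\<Sum>k<n. z k) = 1"
  shows "(\<Sum>i<N. block_replace n b x z i) = (\<Sum>i<N. x i)"
proof -
  have split: "(\<Sum>i<N. h i) = (\<Sum>k<n. h (b k)) + (\<Sum>i\<in>{..<N} - b ` {..<n}. h i)" for h :: "nat \<Rightarrow> real"
    using sum.subset_diff[OF b(2), of h] sum.reindex[OF b(1), of h] by (simp add: add.commute)
  have "(\<Sum>i\<in>{..<N} - b ` {..<n}. block_replace n b x z i) = (\<Sum>i\<in>{..<N} - b ` {..<n}. x i)"
    by (rule sum.cong) (auto simp: block_replace_out)
  then show ?thesis
    by (simp only: split block_sum_block_replace[OF b(1) z])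
qed

lemma scale_block_replace:
  assumes "b ` {..<n} \<subseteq> {..<N}"
  shows "scale_config N c (block_replace n b x z) = block_replace n b (scale_config N c x) z"
proof -
  have "(\<Sum>k<n. scale_config N c x (b k)) = c * (\<Sum>k<n. x (b k))"
    using assms by (auto simp: scale_config_def sum_distrib_left intro!: sum.cong)
  then show ?thesis
    using assms by (auto simp: fun_eq_iff block_replace_def scale_config_def)
qed

text \<open>Fubini separates the block from the other sites. Relabelled through \<open>b\<close>,
  the block is a Gamma vector of length \<open>n\<close>, whose direction can be redrawn
  independently of its sum.\<close>

lemma nn_integral_PiM_gamma_block:
  assumes \<gamma>: "\<gamma> > 0" and b: "inj_on b {..<n}" "b ` {..<n} \<subseteq> {..<N}" and n: "n \<ge> 1"
    and [measurable]: "\<phi> \<in> borel_measurable (config_space N)"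
  shows "(\<integral>\<^sup>+x. \<phi> x \<partial>PiM {..<N} (\<lambda>_. gamma_law \<gamma>)) =
    (\<integral>\<^sup>+x. (\<integral>\<^sup>+z. \<phi> (block_replace n b x z) \<partial>nu_cond \<gamma> (1 / real n) n) \<partial>PiM {..<N} (\<lambda>_. gamma_law \<gamma>))"
proof -
  interpret nu: prob_space "nu_cond \<gamma> (1 / real n) n" using \<gamma> n by (intro prob_space_nu_cond) auto
  interpret g: product_sigma_finite "\<lambda>_::nat. gamma_law \<gamma>"
    using prob_space_gamma_law[OF \<gamma>] by (simp add: product_sigma_finite_def prob_space_imp_sigma_finite)
  let ?B = "b ` {..<n}" and ?i = "inv_into {..<n} b"
  let ?R = "{..<N} - ?B"
  let ?P = "\<lambda>I. PiM I (\<lambda>_. gamma_law \<gamma>)"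
  define join where "join u w = (\<lambda>i. if i \<in> ?B then w (?i i) else if i \<in> ?R then u i else undefined)" for u w :: "nat \<Rightarrow> real"
  have un: "?R \<union> ?B = {..<N}" using b by auto
  have i: "?i i < n" if "i \<in> ?B" for i using inv_into_into[OF that] by simp
  have join_m: "join u \<in> measurable (config_space n) (config_space N)" for u
  proof (rule measurable_configI)
    fix i assume "i < N"
    then show "(\<lambda>w. join u w i) \<in> borel_measurable (config_space n)"
      using i by (cases "i \<in> ?B") (auto simp: join_def)
  qed (use b in \<open>auto simp: join_def\<close>)
  have reindex: "distr (?P {..<n}) (?P ?B) (\<lambda>\<omega>. \<lambda>i\<in>?B. \<omega> (?i i)) = ?P ?B"
    using b i by (intro distr_PiM_reindex prob_space_gamma_law \<gamma>) (auto intro: inj_on_inv_into)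
  have fold: "(\<integral>\<^sup>+x. \<psi> x \<partial>?P {..<N}) = (\<integral>\<^sup>+u. (\<integral>\<^sup>+w. \<psi> (join u w) \<partial>?P {..<n}) \<partial>?P ?R)"
    if \<psi>: "\<psi> \<in> borel_measurable (config_space N)" for \<psi>
  proof -
    have m: "\<psi> \<in> borel_measurable (?P (?R \<union> ?B))"
      unfolding un using \<psi> by measurable
    have "(\<integral>\<^sup>+x. \<psi> x \<partial>?P (?R \<union> ?B)) = (\<integral>\<^sup>+u. (\<integral>\<^sup>+v. \<psi> (merge ?R ?B (u, v)) \<partial>?P ?B) \<partial>?P ?R)"
      by (rule g.product_nn_integral_fold[OF _ _ _ m]) auto
    also have "\<dots> = (\<integral>\<^sup>+u. (\<integral>\<^sup>+w. \<psi> (join u w) \<partial>?P {..<n}) \<partial>?P ?R)"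
    proof (rule nn_integral_cong)
      fix u assume u: "u \<in> space (?P ?R)"
      have "(\<lambda>v. merge ?R ?B (u, v)) \<in> measurable (?P ?B) (?P (?R \<union> ?B))"
        using u by (intro measurable_compose[OF measurable_Pair measurable_merge]) auto
      from measurable_compose[OF this m] have m2: "(\<lambda>v. \<psi> (merge ?R ?B (u, v))) \<in> borel_measurable (?P ?B)" .
      have m3: "(\<lambda>\<omega>. \<lambda>i\<in>?B. \<omega> (?i i)) \<in> measurable (?P {..<n}) (?P ?B)"
        using i by (intro measurable_restrict measurable_component_singleton) auto
      have mj: "merge ?R ?B (u, \<lambda>i\<in>?B. w (?i i)) = join u w" for w
        by (auto simp: merge_def join_def fun_eq_iff)
      have "(\<integral>\<^sup>+v. \<psi> (merge ?R ?B (u, v)) \<partial>?P ?B) = (\<integral>\<^sup>+v. \<psi> (merge ?R ?B (u, v)) \<partial>distr (?P {..<n}) (?P ?B) (\<lambda>\<omega>. \<lambda>i\<in>?B. \<omega> (?i i)))"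
        by (simp only: reindex)
      also have "\<dots> = (\<integral>\<^sup>+w. \<psi> (merge ?R ?B (u, \<lambda>i\<in>?B. w (?i i))) \<partial>?P {..<n})"
        by (rule nn_integral_distr[OF m3]) (simp add: m2)
      also have "\<dots> = (\<integral>\<^sup>+w. \<psi> (join u w) \<partial>?P {..<n})"
        unfolding mj ..
      finally show "(\<integral>\<^sup>+v. \<psi> (merge ?R ?B (u, v)) \<partial>?P ?B) = (\<integral>\<^sup>+w. \<psi> (join u w) \<partial>?P {..<n})" .
    qed
    finally show ?thesis by (simp only: un)
  qed
  \<comment> \<open>The sum of \<open>w\<close> is the block energy of \<open>join u w\<close>, so
    scaling fresh proportions by that sum is the same as replacing the block.\<close>
  have jr: "join u (scale_config n (\<Sum>k<n. w k) z) = block_replace n b (join u w) z" for u w z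
  proof -
    have "(\<Sum>k<n. join u w (b k)) = (\<Sum>k<n. w k)"
      using b by (intro sum.cong) (auto simp: join_def)
    then show ?thesis using i
      by (auto simp: fun_eq_iff block_replace_def) (auto simp: join_def scale_config_def)
  qed
  define \<Psi> where "\<Psi> x = (\<integral>\<^sup>+z. \<phi> (block_replace n b x z) \<partial>nu_cond \<gamma> (1 / real n) n)" for x
  have \<Psi>: "\<Psi> \<in> borel_measurable (config_space N)"
    unfolding \<Psi>_def[abs_def] using b by measurable
  have "(\<integral>\<^sup>+x. \<phi> x \<partial>?P {..<N}) = (\<integral>\<^sup>+u. (\<integral>\<^sup>+w. \<phi> (join u w) \<partial>?P {..<n}) \<partial>?P ?R)"
    by (rule fold) simp
  also have "\<dots> = (\<integral>\<^sup>+u. (\<integral>\<^sup>+w. \<Psi> (join u w) \<partial>?P {..<n}) \<partial>?P ?R)"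
  proof (rule nn_integral_cong)
    fix u
    have "(\<lambda>w. \<phi> (join u w)) \<in> borel_measurable (config_space n)"
      by (rule measurable_compose[OF join_m]) simp
    from nn_integral_PiM_gamma_resample[OF \<gamma> n this]
    show "(\<integral>\<^sup>+w. \<phi> (join u w) \<partial>?P {..<n}) = (\<integral>\<^sup>+w. \<Psi> (join u w) \<partial>?P {..<n})"
      by (simp only: jr \<Psi>_def)
  qed
  also have "\<dots> = (\<integral>\<^sup>+x. \<Psi> x \<partial>?P {..<N})"
    by (rule fold[OF \<Psi>, symmetric])
  finally show ?thesis unfolding \<Psi>_def .
qed

text \<open>Redrawing the proportions of a block leaves the total energy unchanged, hence commutes
  with the normalisation that turns a Gamma vector into a sample of \<nu>.\<close>

lemma nn_integral_nu_cond_block: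
  assumes \<gamma>: "\<gamma> > 0" and E: "E > 0" and b: "inj_on b {..<n}" "b ` {..<n} \<subseteq> {..<N}" and n: "n \<ge> 1"
    and [measurable]: "\<phi> \<in> borel_measurable (config_space N)"
  shows "(\<integral>\<^sup>+x. \<phi> x \<partial>nu_cond \<gamma> E N) =
    (\<integral>\<^sup>+x. (\<integral>\<^sup>+z. \<phi> (block_replace n b x z) \<partial>nu_cond \<gamma> (1 / real n) n) \<partial>nu_cond \<gamma> E N)"
proof -
  have "card (b ` {..<n}) \<le> card {..<N}" using b by (intro card_mono) auto
  then have N: "N \<ge> 1" using n b by (simp add: card_image)
  interpret nu: prob_space "nu_cond \<gamma> (1 / real n) n" using \<gamma> n by (intro prob_space_nu_cond) auto
  let ?c = "\<lambda>x. real N * E / (\<Sum>i<N. x i)"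
  let ?P = "PiM {..<N} (\<lambda>_. gamma_law \<gamma>)"
  define \<Psi> where "\<Psi> x = (\<integral>\<^sup>+z. \<phi> (block_replace n b x z) \<partial>nu_cond \<gamma> (1 / real n) n)" for x
  have \<Psi>: "\<Psi> \<in> borel_measurable (config_space N)"
    unfolding \<Psi>_def[abs_def] using b by measurable
  have "(\<integral>\<^sup>+x. \<phi> x \<partial>nu_cond \<gamma> E N) = (\<integral>\<^sup>+x. \<phi> (scale_config N (?c x) x) \<partial>?P)"
    by (rule nn_integral_nu_cond_gamma[OF \<gamma> N E]) simp
  also have "\<dots> = (\<integral>\<^sup>+x. (\<integral>\<^sup>+z. \<phi> (scale_config N (?c (block_replace n b x z)) (block_replace n b x z)) \<partial>nu_cond \<gamma> (1 / real n) n) \<partial>?P)"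
    by (rule nn_integral_PiM_gamma_block[OF \<gamma> b n]) measurable
  also have "\<dots> = (\<integral>\<^sup>+x. \<Psi> (scale_config N (?c x) x) \<partial>?P)"
    unfolding \<Psi>_def
  proof (rule nn_integral_cong, rule nn_integral_cong_AE)
    fix x
    show "AE z in nu_cond \<gamma> (1 / real n) n. \<phi> (scale_config N (?c (block_replace n b x z)) (block_replace n b x z)) =
       \<phi> (block_replace n b (scale_config N (?c x) x) z)"
      using AE_nu_cond_simplex[OF n, where \<gamma>=\<gamma> and E="1 / real n"]
    proof eventually_elim
      fix z assume "(\<forall>i<n. 0 < z i) \<and> (\<Sum>i<n. z i) = real n * (1 / real n)"
      then have "(\<Sum>i<n. z i) = 1" using n by simp
      then show "\<phi> (scale_config N (?c (block_replace n b x z)) (block_replace n b x z)) =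
       \<phi> (block_replace n b (scale_config N (?c x) x) z)"
        by (simp add: sum_block_replace[OF b] scale_block_replace[OF b(2)])
    qed
  qed
  also have "\<dots> = (\<integral>\<^sup>+x. \<Psi> x \<partial>nu_cond \<gamma> E N)"
    by (rule nn_integral_nu_cond_gamma[OF \<gamma> N E \<Psi>, symmetric])
  finally show ?thesis unfolding \<Psi>_def .
qed

section \<open>Blocks of two sites and the Beta law\<close>

definition pair_config :: "real \<Rightarrow> nat \<Rightarrow> real" where
  "pair_config a = (\<lambda>i. if i = 0 then a else if i = 1 then 1 - a else undefined)"

definition pair_block :: "nat \<Rightarrow> nat \<Rightarrow> nat \<Rightarrow> nat" where
  "pair_block i j = (\<lambda>k. if k = 0 then i else j)"

lemma measurable_pair_config [measurable]: "pair_config \<in> measurable borel (config_space 2)"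
  by (rule measurable_configI) (unfold pair_config_def, measurable, auto)

lemma sets_beta_sym [simp, measurable_cong]: "sets (beta_sym \<gamma>) = sets borel"
  by (simp add: beta_sym_def)

lemma space_beta_sym [simp]: "space (beta_sym \<gamma>) = UNIV"
  by (simp add: beta_sym_def)

text \<open>The two-site simplex of sum one is an interval, on which the weight is the symmetric
  Beta density; its mass \<open>Gamma \<gamma> ^ 2 / Gamma (2 * \<gamma>)\<close> is
  \<open>Beta \<gamma> \<gamma>\<close>.\<close>

lemma nn_integral_nu_cond_2:
  assumes \<gamma>: "\<gamma> > 0" and [measurable]: "\<phi> \<in> borel_measurable (config_space 2)"
  shows "(\<integral>\<^sup>+x. \<phi> x \<partial>nu_cond \<gamma> (1 / 2) 2) = (\<integral>\<^sup>+a. \<phi> (pair_config a) \<partial>beta_sym \<gamma>)"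
proof -
  define w :: "real \<Rightarrow> real" where "w a = indicator {0<..<1} a * a powr (\<gamma> - 1) * (1 - a) powr (\<gamma> - 1)" for a
  have [measurable]: "w \<in> borel_measurable borel" unfolding w_def by measurable
  have w: "cond_weight \<gamma> (1 / 2) 2 y = w (y 0)" for y
    by (auto simp: cond_weight_def simplex_param_def Let_def w_def numeral_2_eq_2 less_Suc_eq indicator_def)
  have s: "simplex_param (1 / 2) 2 y = pair_config (y 0)" for y
    by (auto simp: simplex_param_def pair_config_def fun_eq_iff)
  have one: "{..<2 - 1 :: nat} = {0}" by auto
  have B: "Beta \<gamma> \<gamma> > 0" "cond_norm \<gamma> (1 / 2) 2 = ennreal (Beta \<gamma> \<gamma>)"
    using \<gamma> cond_norm_unit[OF \<gamma>, of 2] by (simp_all add: Beta_def power2_eq_square)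
  have w0: "w a \<ge> 0" for a by (simp add: w_def)
  have "(\<integral>\<^sup>+x. \<phi> x \<partial>nu_cond \<gamma> (1 / 2) 2) = simplex_int \<gamma> (1 / 2) 2 \<phi> / cond_norm \<gamma> (1 / 2) 2"
    by (rule nn_integral_nu_cond) auto
  also have "simplex_int \<gamma> (1 / 2) 2 \<phi> = (\<integral>\<^sup>+y. \<phi> (pair_config (y 0)) * ennreal (w (y 0)) \<partial>PiM {0 :: nat} (\<lambda>_. lborel))"
    by (simp only: simplex_int_def w s one)
  also have "\<dots> = (\<integral>\<^sup>+a. \<phi> (pair_config a) * ennreal (w a) \<partial>lborel)"
    by (rule lborel_prod.product_nn_integral_singleton) measurable
  also have "\<dots> / cond_norm \<gamma> (1 / 2) 2 = (\<integral>\<^sup>+a. \<phi> (pair_config a) * ennreal (w a) / cond_norm \<gamma> (1 / 2) 2 \<partial>lborel)"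
    by (rule nn_integral_divide[symmetric]) measurable
  also have "\<dots> = (\<integral>\<^sup>+a. ennreal (w a / Beta \<gamma> \<gamma>) * \<phi> (pair_config a) \<partial>lborel)"
  proof (rule nn_integral_cong)
    fix a
    have "ennreal (w a / Beta \<gamma> \<gamma>) = ennreal (w a) / cond_norm \<gamma> (1 / 2) 2"
      using B w0 by (simp add: divide_ennreal)
    then show "\<phi> (pair_config a) * ennreal (w a) / cond_norm \<gamma> (1 / 2) 2 = ennreal (w a / Beta \<gamma> \<gamma>) * \<phi> (pair_config a)"
      by (simp add: divide_ennreal_def mult_ac)
  qed
  also have "\<dots> = (\<integral>\<^sup>+a. \<phi> (pair_config a) \<partial>beta_sym \<gamma>)"
    unfolding beta_sym_def w_def[symmetric] by (rule nn_integral_density[symmetric]) measurable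
  finally show ?thesis .
qed

lemma prob_space_beta_sym: "\<gamma> > 0 \<Longrightarrow> prob_space (beta_sym \<gamma>)"
proof (rule prob_spaceI)
  assume \<gamma>: "\<gamma> > 0"
  interpret nu: prob_space "nu_cond \<gamma> (1 / 2) 2" using \<gamma> by (intro prob_space_nu_cond) auto
  have "emeasure (beta_sym \<gamma>) (space (beta_sym \<gamma>)) = (\<integral>\<^sup>+a. 1 \<partial>beta_sym \<gamma>)" by simp
  also have "\<dots> = 1"
    using nn_integral_nu_cond_2[OF \<gamma>, of "\<lambda>_. 1"] nu.emeasure_space_1 by simp
  finally show "emeasure (beta_sym \<gamma>) (space (beta_sym \<gamma>)) = 1" .
qed

lemma block_replace_pair:
  assumes "i \<noteq> j"
  shows "block_replace 2 (pair_block i j) x (pair_config a) = Tmove i j a x"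
proof -
  have inj: "inj_on (pair_block i j) {..<2}"
    using assms by (auto simp: inj_on_def pair_block_def less_2_cases_iff)
  have im: "pair_block i j ` {..<2} = {i, j}" by (auto simp: pair_block_def numeral_2_eq_2 lessThan_Suc)
  have "block_replace 2 (pair_block i j) x (pair_config a) i = a * (x i + x j)"
    using block_replace_in[OF inj, of 0 x "pair_config a"] assms by (simp add: pair_block_def pair_config_def numeral_2_eq_2)
  moreover have "block_replace 2 (pair_block i j) x (pair_config a) j = (1 - a) * (x i + x j)"
    using block_replace_in[OF inj, of 1 x "pair_config a"] assms by (simp add: pair_block_def pair_config_def numeral_2_eq_2)
  ultimately show ?thesis
    using block_replace_out[of _ "pair_block i j" 2 x "pair_config a"] im by (auto simp: Tmove_def fun_eq_iff)
qed

lemma measurable_Tmove [measurable]: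
  assumes "i < N" "j < N" and [measurable]: "f \<in> measurable M (config_space N)" "g \<in> borel_measurable M"
  shows "(\<lambda>x. Tmove i j (g x) (f x)) \<in> measurable M (config_space N)"
proof (rule measurable_configI)
  fix k assume "k < N"
  then show "(\<lambda>x. Tmove i j (g x) (f x) k) \<in> borel_measurable M"
    using assms(1,2) by (cases "k = i"; cases "k = j") (simp_all add: Tmove_def)
next
  fix x k assume x: "x \<in> space M" and "\<not> k < N"
  then show "Tmove i j (g x) (f x) k = undefined"
    using measurable_space[OF assms(3) x] assms(1,2) by (auto simp: space_config_space extensional_def Tmove_def)
qed

text \<open>An energy exchange is the resampling of a block of two sites, so \<nu> is stationary
  under it.\<close>

lemma nn_integral_nu_cond_Tmove:
  assumes \<gamma>: "\<gamma> > 0" and E: "E > 0" and ij: "i < N" "j < N" "i \<noteq> j"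
    and [measurable]: "\<phi> \<in> borel_measurable (config_space N)"
  shows "(\<integral>\<^sup>+x. \<phi> x \<partial>nu_cond \<gamma> E N) = (\<integral>\<^sup>+x. (\<integral>\<^sup>+a. \<phi> (Tmove i j a x) \<partial>beta_sym \<gamma>) \<partial>nu_cond \<gamma> E N)"
proof -
  let ?b = "pair_block i j"
  have b: "inj_on ?b {..<2}" "?b ` {..<2} \<subseteq> {..<N}"
    using ij by (auto simp: inj_on_def pair_block_def less_2_cases_iff)
  have "(\<integral>\<^sup>+x. \<phi> x \<partial>nu_cond \<gamma> E N) = (\<integral>\<^sup>+x. (\<integral>\<^sup>+z. \<phi> (block_replace 2 ?b x z) \<partial>nu_cond \<gamma> (1 / real 2) 2) \<partial>nu_cond \<gamma> E N)"
    by (rule nn_integral_nu_cond_block[OF \<gamma> E b]) auto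
  also have "\<dots> = (\<integral>\<^sup>+x. (\<integral>\<^sup>+a. \<phi> (Tmove i j a x) \<partial>beta_sym \<gamma>) \<partial>nu_cond \<gamma> E N)"
  proof (rule nn_integral_cong)
    fix x assume x: "x \<in> space (nu_cond \<gamma> E N)"
    then have [measurable]: "block_replace 2 ?b x \<in> measurable (config_space 2) (config_space N)"
      by (intro measurable_block_replace[OF b]) auto
    show "(\<integral>\<^sup>+z. \<phi> (block_replace 2 ?b x z) \<partial>nu_cond \<gamma> (1 / real 2) 2) = (\<integral>\<^sup>+a. \<phi> (Tmove i j a x) \<partial>beta_sym \<gamma>)"
      using nn_integral_nu_cond_2[OF \<gamma>, of "\<lambda>z. \<phi> (block_replace 2 ?b x z)"]
      by (simp add: block_replace_pair[OF ij(3)])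
  qed
  finally show ?thesis .
qed

section \<open>Weighted square norms and local Dirichlet forms\<close>

text \<open>The mean minimises the mean square deviation. An infinite right side is trivial, and a
  finite one makes \<open>g\<close> square integrable.\<close>

lemma (in prob_space) nn_integral_variance_le:
  fixes g :: "'a \<Rightarrow> real"
  assumes [measurable]: "g \<in> borel_measurable M"
  shows "(\<integral>\<^sup>+x. ennreal ((expectation g - g x)\<^sup>2) \<partial>M) \<le> (\<integral>\<^sup>+x. ennreal ((g x - c)\<^sup>2) \<partial>M)"
proof (cases "(\<integral>\<^sup>+x. ennreal ((g x - c)\<^sup>2) \<partial>M) = \<infinity>")
  case False
  have i2: "integrable M (\<lambda>x. (g x - c)\<^sup>2)"
    using False by (intro integrableI_nonneg) (auto simp: less_top[symmetric])
  then have i1: "integrable M (\<lambda>x. g x - c)"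
    by (rule square_integrable_imp_integrable[rotated]) auto
  have "integrable M (\<lambda>x. (g x - c) + c)" using i1 by (intro Bochner_Integration.integrable_add) auto
  then have ig: "integrable M g" by simp
  then have eq: "expectation (\<lambda>x. g x - c) = expectation g - c" by (simp add: prob_space)
  have v: "variance (\<lambda>x. g x - c) = expectation (\<lambda>x. (g x - c)\<^sup>2) - (expectation (\<lambda>x. g x - c))\<^sup>2"
    using i1 i2 by (rule variance_eq)
  have s: "(g x - c - (expectation g - c))\<^sup>2 = (expectation g - g x)\<^sup>2" for x
    by (simp add: power2_eq_square algebra_simps)
  have le: "expectation (\<lambda>x. (expectation g - g x)\<^sup>2) \<le> expectation (\<lambda>x. (g x - c)\<^sup>2)"
    using v unfolding eq s by simp
  have i3: "integrable M (\<lambda>x. (expectation g - g x)\<^sup>2)"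
  proof -
    have "integrable M (\<lambda>x. (g x - c)\<^sup>2 - 2 * (expectation g - c) * (g x - c) + (expectation g - c)\<^sup>2)"
      using i1 i2 by auto
    moreover have "(\<lambda>x. (g x - c)\<^sup>2 - 2 * (expectation g - c) * (g x - c) + (expectation g - c)\<^sup>2) = (\<lambda>x. (expectation g - g x)\<^sup>2)"
      by (rule ext) (simp add: power2_eq_square algebra_simps)
    ultimately show ?thesis by simp
  qed
  show ?thesis
    using le by (simp add: nn_integral_eq_integral[OF i2] nn_integral_eq_integral[OF i3])
qed simp

lemma Tmove_Tmove [simp]: "i \<noteq> j \<Longrightarrow> Tmove i j a (Tmove i j b x) = Tmove i j a x"
  by (auto simp: Tmove_def fun_eq_iff algebra_simps)

lemma Tmove_sum [simp]: "i \<noteq> j \<Longrightarrow> Tmove i j a x i + Tmove i j a x j = x i + x j"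
  by (auto simp: Tmove_def algebra_simps)

lemma Tmove_transpose: "i \<noteq> j \<Longrightarrow> Tmove i j a (x \<circ> Transposition.transpose i j) = Tmove i j a x"
  by (auto simp: Tmove_def fun_eq_iff Transposition.transpose_def add.commute)

lemma Eop_Tmove: "i \<noteq> j \<Longrightarrow> Eop \<gamma> i j f (Tmove i j a x) = Eop \<gamma> i j f x"
  by (simp add: Eop_def)

lemma Dop_Tmove: "i \<noteq> j \<Longrightarrow> Dop \<gamma> i j f (Tmove i j a x) = Eop \<gamma> i j f x - f (Tmove i j a x)"
  by (simp add: Dop_def Eop_Tmove)

lemma measurable_Eop [measurable]:
  assumes "\<gamma> > 0" "i < N" "j < N" and [measurable]: "f \<in> borel_measurable (config_space N)"
  shows "Eop \<gamma> i j f \<in> borel_measurable (config_space N)"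
proof -
  interpret b: prob_space "beta_sym \<gamma>" by (rule prob_space_beta_sym[OF assms(1)])
  show ?thesis
    unfolding Eop_def[abs_def]
    by (rule b.borel_measurable_lebesgue_integral) (use assms in measurable)
qed

lemma measurable_Dop [measurable]:
  assumes "\<gamma> > 0" "i < N" "j < N" and [measurable]: "f \<in> borel_measurable (config_space N)"
  shows "Dop \<gamma> i j f \<in> borel_measurable (config_space N)"
  unfolding Dop_def[abs_def] using assms by measurable

locale energy_simplex =
  fixes \<gamma> m E :: real and N :: nat
  assumes \<gamma>: "\<gamma> > 0" and m: "m \<ge> 0" and E: "E > 0" and N: "N \<ge> 1"
begin

abbreviation "\<nu> \<equiv> nu_cond \<gamma> E N"

definition wsq :: "((nat \<Rightarrow> real) \<Rightarrow> real) \<Rightarrow> ((nat \<Rightarrow> real) \<Rightarrow> real) \<Rightarrow> ennreal" where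
  "wsq w u = (\<integral>\<^sup>+x. ennreal (w x * (u x)\<^sup>2) \<partial>\<nu>)"

sublocale nu: prob_space \<nu>
  by (rule prob_space_nu_cond[OF \<gamma> N E])

sublocale beta: prob_space "beta_sym \<gamma>"
  by (rule prob_space_beta_sym[OF \<gamma>])

lemma AE_simplex: "AE x in \<nu>. (\<forall>i<N. 0 < x i) \<and> (\<Sum>i<N. x i) = real N * E"
  by (rule AE_nu_cond_simplex[OF N])

lemma wsq_mono:
  assumes "AE x in \<nu>. w x * (u x)\<^sup>2 \<le> w' x * (v x)\<^sup>2"
  shows "wsq w u \<le> wsq w' v"
  unfolding wsq_def
  by (rule nn_integral_mono_AE, rule eventually_mono[OF assms], rule ennreal_leI)

lemma wsq_minus: "wsq w (\<lambda>x. u x - v x) = wsq w (\<lambda>x. v x - u x)"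
  unfolding wsq_def by (simp add: power2_commute)

text \<open>Cauchy-Schwarz; the factor \<open>n\<close> is how the length of a path enters the final
  bound.\<close>

lemma wsq_sum:
  assumes w: "\<And>x. 0 \<le> w x" and [measurable]: "w \<in> borel_measurable (config_space N)"
    and u[measurable]: "\<And>k. k < n \<Longrightarrow> u k \<in> borel_measurable (config_space N)"
  shows "wsq w (\<lambda>x. \<Sum>k<n. u k x) \<le> ennreal (real n) * (\<Sum>k<n. wsq w (u k))"
proof -
  have "wsq w (\<lambda>x. \<Sum>k<n. u k x) \<le> (\<integral>\<^sup>+x. ennreal (real n) * (\<Sum>k<n. ennreal (w x * (u k x)\<^sup>2)) \<partial>\<nu>)"
    unfolding wsq_def
  proof (rule nn_integral_mono)
    fix x
    have "(\<Sum>k<n. u k x)\<^sup>2 \<le> real n * (\<Sum>k<n. (u k x)\<^sup>2)"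
      using sum_squared_le_sum_of_squares[of "\<lambda>k. u k x" "{..<n}"] by (simp add: mult.commute)
    then have "w x * (\<Sum>k<n. u k x)\<^sup>2 \<le> w x * (real n * (\<Sum>k<n. (u k x)\<^sup>2))"
      using w by (rule mult_left_mono)
    also have "\<dots> = real n * (\<Sum>k<n. w x * (u k x)\<^sup>2)" by (simp add: sum_distrib_left mult_ac)
    finally have "ennreal (w x * (\<Sum>k<n. u k x)\<^sup>2) \<le> ennreal (real n * (\<Sum>k<n. w x * (u k x)\<^sup>2))"
      by (rule ennreal_leI)
    also have "\<dots> = ennreal (real n) * (\<Sum>k<n. ennreal (w x * (u k x)\<^sup>2))"
      using w by (subst ennreal_mult) (auto intro!: sum_nonneg simp: sum_ennreal)
    finally show "ennreal (w x * (\<Sum>k<n. u k x)\<^sup>2) \<le> \<dots>" .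
  qed
  also have "\<dots> = ennreal (real n) * (\<Sum>k<n. wsq w (u k))"
  proof -
    have "(\<integral>\<^sup>+x. ennreal (real n) * (\<Sum>k<n. ennreal (w x * (u k x)\<^sup>2)) \<partial>\<nu>) = ennreal (real n) * (\<integral>\<^sup>+x. (\<Sum>k<n. ennreal (w x * (u k x)\<^sup>2)) \<partial>\<nu>)"
      by (rule nn_integral_cmult) measurable
    also have "(\<integral>\<^sup>+x. (\<Sum>k<n. ennreal (w x * (u k x)\<^sup>2)) \<partial>\<nu>) = (\<Sum>k<n. wsq w (u k))"
      unfolding wsq_def by (rule nn_integral_sum) measurable
    finally show ?thesis .
  qed
  finally show ?thesis .
qed

lemma wsq_add:
  assumes "\<And>x. 0 \<le> w x" and "w \<in> borel_measurable (config_space N)"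
    and "u \<in> borel_measurable (config_space N)" "v \<in> borel_measurable (config_space N)"
  shows "wsq w (\<lambda>x. u x + v x) \<le> 2 * (wsq w u + wsq w v)"
  using wsq_sum[of w 2 "\<lambda>k. if k = 0 then u else v"] assms
  by (simp add: numeral_2_eq_2 lessThan_Suc add.commute)

lemma wsq_add3:
  assumes "\<And>x. 0 \<le> w x" and "w \<in> borel_measurable (config_space N)"
    and "u \<in> borel_measurable (config_space N)" "v \<in> borel_measurable (config_space N)" "z \<in> borel_measurable (config_space N)"
  shows "wsq w (\<lambda>x. u x + v x + z x) \<le> 3 * (wsq w u + wsq w v + wsq w z)"
  using wsq_sum[of w 3 "\<lambda>k. if k = 0 then u else if k = 1 then v else z"] assms
  by (simp add: numeral_3_eq_3 lessThan_Suc add_ac)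

text \<open>Exchangeability removes the permutation once the weight is dominated by a permuted one.
  This is how the energy of a fixed site controls the rate at the place to which it has been
  carried.\<close>

lemma wsq_permute_le:
  assumes p: "p permutes {..<N}" and [measurable]: "w' \<in> borel_measurable (config_space N)" "u \<in> borel_measurable (config_space N)"
    and w: "AE x in \<nu>. w x \<le> w' (x \<circ> p)"
  shows "wsq w (\<lambda>x. u (x \<circ> p)) \<le> wsq w' u"
proof -
  have "wsq w (\<lambda>x. u (x \<circ> p)) \<le> (\<integral>\<^sup>+x. ennreal (w' (x \<circ> p) * (u (x \<circ> p))\<^sup>2) \<partial>\<nu>)"
    unfolding wsq_def using w
    by (intro nn_integral_mono_AE) (elim AE_mp, intro AE_I2 impI ennreal_leI mult_right_mono, auto)
  also have "\<dots> = wsq w' u"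
    unfolding wsq_def by (rule nn_integral_nu_cond_permute[OF \<gamma> N E p, of "\<lambda>x. ennreal (w' x * (u x)\<^sup>2)"]) measurable
  finally show ?thesis .
qed

text \<open>Insert \<open>c\<close> between the two values of \<open>f\<close>. As \<open>w\<close>,
  \<open>c\<close> and \<nu> are all invariant under \<open>p\<close>, both halves have the same
  norm, and \<open>(a + b)^2 \<le> 2 * (a^2 + b^2)\<close> gives the factor 4. In the applications
  \<open>c\<close> is an average over a block containing the sites moved by
  \<open>p\<close>.\<close>

lemma wsq_permute_diff_le:
  assumes p: "p permutes {..<N}" and [measurable]: "w \<in> borel_measurable (config_space N)"
    "f \<in> borel_measurable (config_space N)" "c \<in> borel_measurable (config_space N)"
    and w0: "\<And>x. 0 \<le> w x" and w: "\<And>x. w (x \<circ> p) = w x" and c: "\<And>x. c (x \<circ> p) = c x"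
  shows "wsq w (\<lambda>x. f (x \<circ> p) - f x) \<le> 4 * wsq w (\<lambda>x. f x - c x)"
proof -
  note [measurable] = measurable_permuted[OF p]
  have "wsq w (\<lambda>x. f (x \<circ> p) - f x) = wsq w (\<lambda>x. (f (x \<circ> p) - c (x \<circ> p)) + (c x - f x))"
    by (simp add: c)
  also have "\<dots> \<le> 2 * (wsq w (\<lambda>x. f (x \<circ> p) - c (x \<circ> p)) + wsq w (\<lambda>x. c x - f x))"
    by (rule wsq_add[OF w0]) measurable
  also have "\<dots> \<le> 2 * (wsq w (\<lambda>x. f x - c x) + wsq w (\<lambda>x. f x - c x))"
  proof (intro mult_left_mono add_mono)
    show "wsq w (\<lambda>x. f (x \<circ> p) - c (x \<circ> p)) \<le> wsq w (\<lambda>x. f x - c x)"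
      by (rule wsq_permute_le[OF p, of w "\<lambda>x. f x - c x"]) (auto simp: w)
    show "wsq w (\<lambda>x. c x - f x) \<le> wsq w (\<lambda>x. f x - c x)"
      by (simp add: wsq_minus[of w c f])
  qed simp
  also have "\<dots> = 4 * wsq w (\<lambda>x. f x - c x)"
    by (simp add: mult_2[symmetric] mult.assoc[symmetric])
  finally show ?thesis .
qed

text \<open>Given everything but the split of \<open>x i + x j\<close>, the functions
  \<open>w\<close> and \<open>h\<close> are constant and \<open>Eop\<close> is the conditional mean
  of \<open>f\<close>, hence its best constant approximation.\<close>

lemma wsq_Dop_le:
  assumes ij: "i < N" "j < N" "i \<noteq> j" and [measurable]: "f \<in> borel_measurable (config_space N)"
    "w \<in> borel_measurable (config_space N)" "h \<in> borel_measurable (config_space N)"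
    and w0: "\<And>x. 0 \<le> w x" and w: "\<And>a x. w (Tmove i j a x) = w x" and h: "\<And>a x. h (Tmove i j a x) = h x"
  shows "wsq w (Dop \<gamma> i j f) \<le> wsq w (\<lambda>x. f x - h x)"
proof -
  note [measurable] = measurable_Dop[OF \<gamma> ij(1,2)]
  have T: "Tmove i j a x \<in> space (config_space N)" if "x \<in> space (config_space N)" for a x
    using that ij by (auto simp: Tmove_def space_config_space extensional_def)
  have "wsq w (Dop \<gamma> i j f) = (\<integral>\<^sup>+x. (\<integral>\<^sup>+a. ennreal (w x * (Eop \<gamma> i j f x - f (Tmove i j a x))\<^sup>2) \<partial>beta_sym \<gamma>) \<partial>\<nu>)"
    unfolding wsq_def by (subst nn_integral_nu_cond_Tmove[OF \<gamma> E ij]) (simp_all add: w Dop_Tmove[OF ij(3)])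
  also have "\<dots> \<le> (\<integral>\<^sup>+x. (\<integral>\<^sup>+a. ennreal (w x * (f (Tmove i j a x) - h x)\<^sup>2) \<partial>beta_sym \<gamma>) \<partial>\<nu>)"
  proof (rule nn_integral_mono)
    fix x assume "x \<in> space \<nu>"
    then have [measurable]: "(\<lambda>a. Tmove i j a x) \<in> measurable borel (config_space N)"
      using ij by (intro measurable_Tmove) auto
    have "ennreal (w x) * (\<integral>\<^sup>+a. ennreal ((Eop \<gamma> i j f x - f (Tmove i j a x))\<^sup>2) \<partial>beta_sym \<gamma>) \<le>
      ennreal (w x) * (\<integral>\<^sup>+a. ennreal ((f (Tmove i j a x) - h x)\<^sup>2) \<partial>beta_sym \<gamma>)"
      unfolding Eop_def by (intro mult_left_mono beta.nn_integral_variance_le) auto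
    then show "(\<integral>\<^sup>+a. ennreal (w x * (Eop \<gamma> i j f x - f (Tmove i j a x))\<^sup>2) \<partial>beta_sym \<gamma>) \<le>
      (\<integral>\<^sup>+a. ennreal (w x * (f (Tmove i j a x) - h x)\<^sup>2) \<partial>beta_sym \<gamma>)"
      using w0 by (simp add: ennreal_mult nn_integral_cmult)
  qed
  also have "\<dots> = wsq w (\<lambda>x. f x - h x)"
    unfolding wsq_def by (subst nn_integral_nu_cond_Tmove[OF \<gamma> E ij]) (simp_all add: w h)
  finally show ?thesis .
qed

abbreviation pair_weight :: "nat \<Rightarrow> nat \<Rightarrow> (nat \<Rightarrow> real) \<Rightarrow> real" where
  "pair_weight i j x \<equiv> (x i + x j) powr m"

text \<open>The invariant comparison function is the pair average \<open>Eop\<close>, and the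
  distance of \<open>f\<close> to it is \<open>Dop\<close> up to sign.\<close>

lemma wsq_transpose_diff_le:
  assumes ij: "i < N" "j < N" "i \<noteq> j" and [measurable]: "f \<in> borel_measurable (config_space N)"
  shows "wsq (pair_weight i j) (\<lambda>x. f (x \<circ> Transposition.transpose i j) - f x) \<le> 4 * wsq (pair_weight i j) (Dop \<gamma> i j f)"
proof -
  note [measurable] = measurable_Eop[OF \<gamma> ij(1,2)]
  have "wsq (pair_weight i j) (\<lambda>x. f (x \<circ> Transposition.transpose i j) - f x) \<le> 4 * wsq (pair_weight i j) (\<lambda>x. f x - Eop \<gamma> i j f x)"
    using ij by (intro wsq_permute_diff_le permutes_swap_id)
     (auto simp: add.commute Eop_def Tmove_transpose)
  also have "wsq (pair_weight i j) (\<lambda>x. f x - Eop \<gamma> i j f x) = wsq (pair_weight i j) (Dop \<gamma> i j f)"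
    unfolding Dop_def[abs_def] by (rule wsq_minus)
  finally show ?thesis .
qed

end

section \<open>The Poincare inequality on three sites\<close>

lemma kappa_poincare:
  assumes \<gamma>: "\<gamma> > 0" and [measurable]: "g \<in> borel_measurable (config_space 3)"
    and fin: "(\<integral>\<^sup>+z. ennreal ((g z)\<^sup>2) \<partial>nu_cond \<gamma> (1/3) 3) < \<infinity>"
  shows "kappa \<gamma> m * (\<integral>\<^sup>+z. ennreal ((g z - (\<integral>z. g z \<partial>nu_cond \<gamma> (1/3) 3))\<^sup>2) \<partial>nu_cond \<gamma> (1/3) 3) \<le>
    (\<Sum>i<2. \<integral>\<^sup>+z. ennreal ((z i + z (Suc i)) powr m * (Dop \<gamma> i (Suc i) g z)\<^sup>2) \<partial>nu_cond \<gamma> (1/3) 3)"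
proof -
  let ?M = "nu_cond \<gamma> (1/3) 3"
  interpret nu: prob_space ?M using \<gamma> by (intro prob_space_nu_cond) auto
  interpret beta: prob_space "beta_sym \<gamma>" by (rule prob_space_beta_sym[OF \<gamma>])
  define c where "c = (\<integral>z. g z \<partial>?M)"
  \<comment> \<open>The gap tests only functions of mean zero, so \<open>g\<close> is centred; it
    then remains to see that the form does not notice the constant.\<close>
  define h where "h z = g z - c" for z
  have [measurable]: "h \<in> borel_measurable (config_space 3)" unfolding h_def by measurable
  have i2: "integrable ?M (\<lambda>z. (g z)\<^sup>2)"
    using fin by (intro integrableI_nonneg) auto
  then have i1: "integrable ?M g" by (rule nu.square_integrable_imp_integrable[rotated]) auto
  have ih1: "integrable ?M h" unfolding h_def using i1 by auto
  have ih2: "integrable ?M (\<lambda>z. (h z)\<^sup>2)"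
    using i1 i2 by (simp add: h_def power2_diff)
  have h0: "(\<integral>z. h z \<partial>?M) = 0" unfolding h_def using i1 by (simp add: c_def nu.prob_space[unfolded space_nu_cond])
  have nn: "(\<integral>\<^sup>+z. ennreal ((h z)\<^sup>2) \<partial>?M) = ennreal (\<integral>z. (h z)\<^sup>2 \<partial>?M)"
    using ih2 by (intro nn_integral_eq_integral) auto
  \<comment> \<open>Where the resampled function fails to be integrable, the integral in
    \<open>Eop\<close> defaults to \<open>0\<close> and the constant would not cancel. Stationarity
    and the finite second moment of \<open>g\<close> confine this to a null set.\<close>
  have D: "(\<integral>\<^sup>+z. ennreal ((z i + z (Suc i)) powr m * (Dop \<gamma> i (Suc i) h z)\<^sup>2) \<partial>?M) =
    (\<integral>\<^sup>+z. ennreal ((z i + z (Suc i)) powr m * (Dop \<gamma> i (Suc i) g z)\<^sup>2) \<partial>?M)" if i: "i < 2" for i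
  proof (rule nn_integral_cong_AE)
    have [measurable]: "(\<lambda>p. Tmove i (Suc i) (snd p) (fst p)) \<in> measurable (?M \<Otimes>\<^sub>M beta_sym \<gamma>) (config_space 3)"
      using i by (intro measurable_Tmove) auto
    have "(\<integral>\<^sup>+z. (\<integral>\<^sup>+a. ennreal ((g (Tmove i (Suc i) a z))\<^sup>2) \<partial>beta_sym \<gamma>) \<partial>?M) = (\<integral>\<^sup>+z. ennreal ((g z)\<^sup>2) \<partial>?M)"
      using i by (intro nn_integral_nu_cond_Tmove[symmetric] \<gamma>) auto
    then have "AE z in ?M. (\<integral>\<^sup>+a. ennreal ((g (Tmove i (Suc i) a z))\<^sup>2) \<partial>beta_sym \<gamma>) \<noteq> \<infinity>"
      using fin by (intro nn_integral_PInf_AE) (auto simp: split_beta' intro!: beta.borel_measurable_nn_integral)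
    then show "AE z in ?M. ennreal ((z i + z (Suc i)) powr m * (Dop \<gamma> i (Suc i) h z)\<^sup>2) =
      ennreal ((z i + z (Suc i)) powr m * (Dop \<gamma> i (Suc i) g z)\<^sup>2)"
      using AE_space
    proof eventually_elim
      fix z assume f: "(\<integral>\<^sup>+a. ennreal ((g (Tmove i (Suc i) a z))\<^sup>2) \<partial>beta_sym \<gamma>) \<noteq> \<infinity>" and z: "z \<in> space ?M"
      have [measurable]: "(\<lambda>a. Tmove i (Suc i) a z) \<in> measurable borel (config_space 3)"
        using i z by (intro measurable_Tmove) auto
      have "integrable (beta_sym \<gamma>) (\<lambda>a. (g (Tmove i (Suc i) a z))\<^sup>2)"
        using f by (intro integrableI_nonneg) (auto simp: less_top[symmetric])
      then have "integrable (beta_sym \<gamma>) (\<lambda>a. g (Tmove i (Suc i) a z))"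
        by (rule beta.square_integrable_imp_integrable[rotated]) auto
      then have "Dop \<gamma> i (Suc i) h z = Dop \<gamma> i (Suc i) g z"
        by (simp add: Dop_def Eop_def h_def beta.prob_space[simplified])
      then show "ennreal ((z i + z (Suc i)) powr m * (Dop \<gamma> i (Suc i) h z)\<^sup>2) =
        ennreal ((z i + z (Suc i)) powr m * (Dop \<gamma> i (Suc i) g z)\<^sup>2)" by simp
    qed
  qed
  have "kappa \<gamma> m * ennreal (\<integral>z. (h z)\<^sup>2 \<partial>?M) \<le> dirichlet_nn \<gamma> m (1/3) 3 h"
  proof (cases "(\<integral>z. (h z)\<^sup>2 \<partial>?M) = 0")
    \<comment> \<open>A function of zero norm is not admissible in the infimum, but for it the left
      side vanishes.\<close>
    case False
    then have pos: "(\<integral>z. (h z)\<^sup>2 \<partial>?M) > 0"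
      by (simp add: order_less_le)
    have "h \<in> test_fns \<gamma> (1/3) 3" using ih2 h0 False by (auto simp: test_fns_def)
    then have "kappa \<gamma> m \<le> dirichlet_nn \<gamma> m (1/3) 3 h / ennreal (\<integral>z. (h z)\<^sup>2 \<partial>?M)"
      unfolding kappa_def gap_nn_def by (rule INF_lower)
    then have "kappa \<gamma> m * ennreal (\<integral>z. (h z)\<^sup>2 \<partial>?M) \<le> dirichlet_nn \<gamma> m (1/3) 3 h / ennreal (\<integral>z. (h z)\<^sup>2 \<partial>?M) * ennreal (\<integral>z. (h z)\<^sup>2 \<partial>?M)"
      by (rule mult_right_mono) simp
    also have "\<dots> = dirichlet_nn \<gamma> m (1/3) 3 h"
      using pos by (simp add: ennreal_divide_times mult_divide_eq_ennreal)
    finally show ?thesis .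
  qed simp
  also have "dirichlet_nn \<gamma> m (1/3) 3 h = (\<Sum>i<2. \<integral>\<^sup>+z. ennreal ((z i + z (Suc i)) powr m * (Dop \<gamma> i (Suc i) g z)\<^sup>2) \<partial>?M)"
    unfolding dirichlet_nn_def using D by (intro sum.cong) auto
  finally show ?thesis unfolding nn[symmetric] by (simp add: h_def c_def)
qed

text \<open>Exchanging proportions inside the block is exchanging energies in the chain. Thus
  \<open>Dop\<close> of the small system, applied to a section of \<open>f\<close>, is
  \<open>Dop\<close> of the chain.\<close>

lemma block_replace_Tmove:
  assumes b: "inj_on b {..<n}" and ij: "i < n" "j < n" "i \<noteq> j"
  shows "block_replace n b x (Tmove i j a z) = Tmove (b i) (b j) a (block_replace n b x z)"
proof
  fix l
  have bij: "b i \<noteq> b j" using b ij by (auto dest: inj_onD)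
  show "block_replace n b x (Tmove i j a z) l = Tmove (b i) (b j) a (block_replace n b x z) l"
  proof (cases "l \<in> b ` {..<n}")
    case True
    then obtain k where k: "k < n" "l = b k" by auto
    have kb: "k = i \<longleftrightarrow> b k = b i" "k = j \<longleftrightarrow> b k = b j" using b ij k by (auto dest: inj_onD)
    show ?thesis
      using k ij bij kb by (simp add: b Tmove_def algebra_simps)
  next
    case False
    then have "l \<noteq> b i" "l \<noteq> b j" using ij by auto
    then show ?thesis using False by (simp add: Tmove_def block_replace_out)
  qed
qed

lemma block_replace_idem:
  assumes "inj_on b {..<n}" "(\<Sum>k<n. z k) = 1"
  shows "block_replace n b (block_replace n b x z) z' = block_replace n b x z'"
proof -
  have "(\<Sum>k<n. block_replace n b x z (b k)) = (\<Sum>k<n. x (b k))"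
    by (rule block_sum_block_replace[OF assms])
  then show ?thesis
    unfolding block_replace_def[of n b "block_replace n b x z"] by (auto simp: block_replace_def)
qed

lemma block_sum_permute:
  fixes x :: "nat \<Rightarrow> real"
  assumes "inj_on b {..<n}" "p permutes b ` {..<n}"
  shows "(\<Sum>k<n. (x \<circ> p) (b k)) = (\<Sum>k<n. x (b k))"
  using sum.reindex[OF assms(1), of "x \<circ> p"] sum.reindex[OF assms(1), of x] sum.permute[OF assms(2), of x] by simp

text \<open>The result depends on the block only through its total energy. Block averages are
  therefore invariant under permutations within the block.\<close>

lemma block_replace_permute:
  assumes "inj_on b {..<n}" "p permutes b ` {..<n}"
  shows "block_replace n b (x \<circ> p) z = block_replace n b x z"
proof -
  have "p i = i" if "i \<notin> b ` {..<n}" for i using that assms(2) by (simp add: permutes_def)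
  then show ?thesis
    unfolding block_replace_def block_sum_permute[OF assms] by (auto simp: fun_eq_iff)
qed

section \<open>Transport of energy along paths\<close>

text \<open>Under \<open>x \<circ> rot3 k\<close>, energies \<open>u, v, w\<close> on three
  consecutive sites become \<open>w, u, v\<close>: the lower pair moves up by one site and the
  energy above it passes below.\<close>

definition rot3 :: "nat \<Rightarrow> nat \<Rightarrow> nat" where
  "rot3 k = Transposition.transpose (Suc k) (Suc (Suc k)) \<circ> Transposition.transpose k (Suc k)"

lemma rot3_apply: "rot3 k l = (if l = k then Suc (Suc k) else if l = Suc k then k else if l = Suc (Suc k) then Suc k else l)"
  by (auto simp: rot3_def Transposition.transpose_def)

lemma rot3_permutes: "{k, Suc k, Suc (Suc k)} \<subseteq> S \<Longrightarrow> rot3 k permutes S"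
  unfolding rot3_def by (intro permutes_compose permutes_swap_id) auto

text \<open>Permutations of the sites: \<open>x \<circ> carry_up i k\<close> has the energy of site \<open>i\<close> carried up to site \<open>k\<close>,
  \<open>x \<circ> carry_down j k\<close> the energy of site \<open>j\<close> carried down to site \<open>k\<close>, and
  \<open>x \<circ> carry_pair i j k\<close> has the energies of \<open>i\<close> and \<open>j\<close> at \<open>k\<close> and \<open>k + 1\<close>.\<close>

definition carry_up :: "nat \<Rightarrow> nat \<Rightarrow> nat \<Rightarrow> nat" where
  "carry_up i k l = (if l = k then i else if i \<le> l \<and> l < k then Suc l else l)"

definition carry_down :: "nat \<Rightarrow> nat \<Rightarrow> nat \<Rightarrow> nat" where
  "carry_down j k l = (if l = k then j else if k < l \<and> l \<le> j then l - 1 else l)"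

definition carry_pair :: "nat \<Rightarrow> nat \<Rightarrow> nat \<Rightarrow> nat \<Rightarrow> nat" where
  "carry_pair i j k l = (if l = k then i else if l = Suc k then j
     else if i \<le> l \<and> l < k then Suc l else if Suc k < l \<and> l \<le> j then l - 1 else l)"

lemma carry_up_self: "carry_up i i = id"
  by (auto simp: carry_up_def fun_eq_iff)

lemma carry_down_self: "carry_down j j = id"
  by (auto simp: carry_down_def fun_eq_iff)

lemma carry_up_Suc: "i \<le> k \<Longrightarrow> carry_up i (Suc k) = carry_up i k \<circ> Transposition.transpose k (Suc k)"
  by (auto simp: carry_up_def fun_eq_iff Transposition.transpose_def)

lemma carry_down_Suc: "k < j \<Longrightarrow> carry_down j k = carry_down j (Suc k) \<circ> Transposition.transpose k (Suc k)"
  by (auto simp: carry_down_def fun_eq_iff Transposition.transpose_def)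

text \<open>The pair path starts where \<open>carry_down\<close> stops and, by the next lemma, ends
  at \<open>carry_up\<close>. So the detour through the pair reaches the configuration in which the
  comparison function is evaluated.\<close>

lemma carry_pair_start: "i < j \<Longrightarrow> carry_pair i j i = carry_down j (Suc i)"
  by (auto simp: carry_pair_def carry_down_def fun_eq_iff)

lemma carry_pair_end: "i \<le> k \<Longrightarrow> carry_pair i (Suc k) k = carry_up i k"
  by (auto simp: carry_pair_def carry_up_def fun_eq_iff)

lemma carry_pair_Suc: "i \<le> k \<Longrightarrow> Suc k < j \<Longrightarrow> carry_pair i j (Suc k) = carry_pair i j k \<circ> rot3 k"
  by (auto simp: carry_pair_def fun_eq_iff rot3_apply)

lemma permutes_carry_up: "i \<le> k \<Longrightarrow> k < N \<Longrightarrow> carry_up i k permutes {..<N}"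
proof (induction rule: dec_induct)
  case base show ?case by (simp only: carry_up_self permutes_id)
next
  case (step n)
  then show ?case by (simp only: carry_up_Suc) (intro permutes_compose permutes_swap_id, auto)
qed

lemma permutes_carry_down: "k \<le> j \<Longrightarrow> j < N \<Longrightarrow> carry_down j k permutes {..<N}"
proof (induction rule: inc_induct)
  case base show ?case by (simp only: carry_down_self permutes_id)
next
  case (step n)
  then show ?case by (simp only: carry_down_Suc) (intro permutes_compose permutes_swap_id, auto)
qed

lemma permutes_carry_pair: "i \<le> k \<Longrightarrow> k < j \<Longrightarrow> j < N \<Longrightarrow> carry_pair i j k permutes {..<N}"
proof (induction rule: dec_induct)
  case base then show ?case by (simp add: carry_pair_start permutes_carry_down)
next
  case (step n)
  then show ?case by (simp only: carry_pair_Suc) (intro permutes_compose rot3_permutes, auto)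
qed

section \<open>Bonds and three-site blocks\<close>

context energy_simplex
begin

definition bond :: "((nat \<Rightarrow> real) \<Rightarrow> real) \<Rightarrow> nat \<Rightarrow> ennreal" where
  "bond f k = wsq (pair_weight k (Suc k)) (Dop \<gamma> k (Suc k) f)"

lemma dirichlet_nn_eq_sum_bond: "dirichlet_nn \<gamma> m E N f = (\<Sum>k<N - 1. bond f k)"
  by (simp add: dirichlet_nn_def bond_def wsq_def)

text \<open>A path that uses each bond at most once costs a single Dirichlet form, whatever its
  length.\<close>

lemma sum_bond_le:
  assumes "inj_on r {..<L}" "\<And>n. n < L \<Longrightarrow> Suc (r n) < N"
  shows "(\<Sum>n<L. bond f (r n)) \<le> dirichlet_nn \<gamma> m E N f"
proof -
  have "(\<Sum>n<L. bond f (r n)) = (\<Sum>k\<in>r ` {..<L}. bond f k)"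
    using sum.reindex[OF assms(1), of "bond f"] by simp
  also have "\<dots> \<le> (\<Sum>k<N - 1. bond f k)"
    using assms(2) by (intro sum_mono2) (auto simp: less_diff_conv)
  finally show ?thesis by (simp add: dirichlet_nn_eq_sum_bond)
qed

lemma bond_le: "Suc k < N \<Longrightarrow> bond f k \<le> dirichlet_nn \<gamma> m E N f"
  using sum_bond_le[of "\<lambda>_. k" "Suc 0" f] by (simp add: inj_on_def)

text \<open>Given the energy \<open>s\<close> of the block, \<open>f\<close> becomes a function of
  proportions on the three-site simplex of sum one, where \<open>kappa\<close> applies. The rates
  are homogeneous of degree \<open>m\<close>, so multiplying the inequality by
  \<open>s powr m\<close> restores the rates of the chain; this is the origin of the weight.\<close>

lemma wsq_block_variance:
  assumes a: "Suc (Suc a) < N" and [measurable]: "f \<in> borel_measurable (config_space N)"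
    and fin: "(\<integral>\<^sup>+x. ennreal ((f x)\<^sup>2) \<partial>\<nu>) < \<infinity>"
  shows "kappa \<gamma> m * wsq (\<lambda>x. (\<Sum>k<3. x (a + k)) powr m)
      (\<lambda>x. f x - (\<integral>z. f (block_replace 3 ((+) a) x z) \<partial>nu_cond \<gamma> (1/3) 3)) \<le> bond f a + bond f (Suc a)"
proof -
  let ?M = "nu_cond \<gamma> (1/3) 3" and ?b = "(+) a" and ?B = "block_replace 3 ((+) a)"
  interpret n3: prob_space ?M using \<gamma> by (intro prob_space_nu_cond) auto
  have b: "inj_on ?b {..<3}" "?b ` {..<3} \<subseteq> {..<N}" using a by auto
  note [measurable] = measurable_block_replace[OF b]
  define W where "W x = (\<Sum>k<3. x (a + k)) powr m" for x :: "nat \<Rightarrow> real"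
  define c where "c x = (\<integral>z. f (?B x z) \<partial>?M)" for x
  have ak: "a + k < N" if "k \<in> {..<3}" for k using that a by auto
  have "(\<lambda>x. x (a + k)) \<in> borel_measurable (config_space N)" if "k \<in> {..<3}" for k
    using ak[OF that] by simp
  then have [measurable]: "(\<lambda>x. \<Sum>k<3. x (a + k)) \<in> borel_measurable (config_space N)"
    by (rule borel_measurable_sum)
  have [measurable]: "W \<in> borel_measurable (config_space N)"
    unfolding W_def[abs_def] by measurable
  have [measurable]: "c \<in> borel_measurable (config_space N)"
    unfolding c_def[abs_def] by (rule n3.borel_measurable_lebesgue_integral) measurable
  have kernel: "(\<integral>\<^sup>+x. \<phi> x \<partial>\<nu>) = (\<integral>\<^sup>+x. (\<integral>\<^sup>+z. \<phi> (?B x z) \<partial>?M) \<partial>\<nu>)" if "\<phi> \<in> borel_measurable (config_space N)" for \<phi>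
    using nn_integral_nu_cond_block[OF \<gamma> E b _ that] by simp
  have Bx: "?B x \<in> measurable (config_space 3) (config_space N)" if "x \<in> space \<nu>" for x
    using that by (intro measurable_block_replace[OF b]) auto
  have one: "AE z in ?M. (\<Sum>k<3. z k) = 1"
    using AE_nu_cond_simplex[of 3 "1/3" \<gamma>] by (auto elim: eventually_mono)
  define V where "V x = (\<integral>\<^sup>+z. ennreal ((f (?B x z) - c x)\<^sup>2) \<partial>?M)" for x
  have [measurable]: "V \<in> borel_measurable (config_space N)"
    unfolding V_def[abs_def] by measurable
  have cB: "c (?B x z) = c x" "W (?B x z) = W x" if "(\<Sum>k<3. z k) = 1" for x z
    using block_sum_block_replace[OF b(1) that, of x] by (simp_all add: c_def W_def block_replace_idem[OF b(1) that])
  have W0: "0 \<le> W x" for x by (simp add: W_def)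
  have "wsq W (\<lambda>x. f x - c x) = (\<integral>\<^sup>+x. (\<integral>\<^sup>+z. ennreal (W (?B x z) * (f (?B x z) - c (?B x z))\<^sup>2) \<partial>?M) \<partial>\<nu>)"
    unfolding wsq_def by (rule kernel) measurable
  also have "\<dots> = (\<integral>\<^sup>+x. ennreal (W x) * V x \<partial>\<nu>)"
  proof (rule nn_integral_cong)
    fix x assume x: "x \<in> space \<nu>"
    note [measurable] = Bx[OF x]
    have "(\<integral>\<^sup>+z. ennreal (W (?B x z) * (f (?B x z) - c (?B x z))\<^sup>2) \<partial>?M) = (\<integral>\<^sup>+z. ennreal (W x) * ennreal ((f (?B x z) - c x)\<^sup>2) \<partial>?M)"
      by (rule nn_integral_cong_AE, rule eventually_mono[OF one]) (simp add: cB ennreal_mult W0)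
    also have "\<dots> = ennreal (W x) * V x"
      unfolding V_def by (rule nn_integral_cmult) measurable
    finally show "(\<integral>\<^sup>+z. ennreal (W (?B x z) * (f (?B x z) - c (?B x z))\<^sup>2) \<partial>?M) = ennreal (W x) * V x" .
  qed
  finally have "kappa \<gamma> m * wsq W (\<lambda>x. f x - c x) = (\<integral>\<^sup>+x. ennreal (W x) * (kappa \<gamma> m * V x) \<partial>\<nu>)"
    by (simp add: nn_integral_cmult[symmetric] mult_ac)
  also have "\<dots> \<le> (\<integral>\<^sup>+x. (\<Sum>i<2. (\<integral>\<^sup>+z. ennreal (pair_weight (a + i) (Suc (a + i)) (?B x z) * (Dop \<gamma> (a + i) (Suc (a + i)) f (?B x z))\<^sup>2) \<partial>?M)) \<partial>\<nu>)"
  proof (rule nn_integral_mono_AE)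
    \<comment> \<open>The three-site inequality asks for a square integrable section of
      \<open>f\<close>; Fubini provides this for almost every \<open>x\<close>.\<close>
    have "(\<integral>\<^sup>+x. (\<integral>\<^sup>+z. ennreal ((f (?B x z))\<^sup>2) \<partial>?M) \<partial>\<nu>) \<noteq> \<infinity>"
      using fin kernel[of "\<lambda>x. ennreal ((f x)\<^sup>2)"] by simp
    then have "AE x in \<nu>. (\<integral>\<^sup>+z. ennreal ((f (?B x z))\<^sup>2) \<partial>?M) \<noteq> \<infinity>"
      by (rule nn_integral_PInf_AE[rotated]) measurable
    then show "AE x in \<nu>. ennreal (W x) * (kappa \<gamma> m * V x) \<le> (\<Sum>i<2. (\<integral>\<^sup>+z. ennreal (pair_weight (a + i) (Suc (a + i)) (?B x z) * (Dop \<gamma> (a + i) (Suc (a + i)) f (?B x z))\<^sup>2) \<partial>?M))"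
      using AE_space
    proof eventually_elim
      fix x assume fx: "(\<integral>\<^sup>+z. ennreal ((f (?B x z))\<^sup>2) \<partial>?M) \<noteq> \<infinity>" and x: "x \<in> space \<nu>"
      note [measurable] = Bx[OF x]
      let ?g = "\<lambda>z. f (?B x z)"
      have D: "Dop \<gamma> i (Suc i) ?g z = Dop \<gamma> (a + i) (Suc (a + i)) f (?B x z)" if "i < 2" for i z
        using block_replace_Tmove[OF b(1), of i "Suc i" x _ z] that by (simp add: Dop_def Eop_def)
      \<comment> \<open>Homogeneity: the block energy to the power \<open>m\<close> times the rate
        in terms of proportions is the rate in terms of energies.\<close>
      have w: "W x * ((z i + z (Suc i)) powr m) = pair_weight (a + i) (Suc (a + i)) (?B x z)" if "i < 2" for i z
        using block_replace_in[OF b(1), of i x z] block_replace_in[OF b(1), of "Suc i" x z] that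
        by (simp add: W_def powr_mult[symmetric] distrib_left)
      have gm: "?g \<in> borel_measurable (config_space 3)" by measurable
      have Dm: "(\<lambda>z. Dop \<gamma> i (Suc i) ?g z) \<in> borel_measurable (config_space 3)" if "i < 2" for i
        using that gm by (intro measurable_Dop[OF \<gamma>]) auto
      have "kappa \<gamma> m * V x \<le> (\<Sum>i<2. \<integral>\<^sup>+z. ennreal ((z i + z (Suc i)) powr m * (Dop \<gamma> i (Suc i) ?g z)\<^sup>2) \<partial>?M)"
        unfolding V_def c_def using fx by (intro kappa_poincare \<gamma> gm) (simp add: less_top[symmetric])
      then have "ennreal (W x) * (kappa \<gamma> m * V x) \<le> ennreal (W x) * (\<Sum>i<2. \<integral>\<^sup>+z. ennreal ((z i + z (Suc i)) powr m * (Dop \<gamma> i (Suc i) ?g z)\<^sup>2) \<partial>?M)"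
        by (rule mult_left_mono) simp
      also have "\<dots> = (\<Sum>i<2. ennreal (W x) * (\<integral>\<^sup>+z. ennreal ((z i + z (Suc i)) powr m * (Dop \<gamma> i (Suc i) ?g z)\<^sup>2) \<partial>?M))"
        by (rule sum_distrib_left)
      also have "\<dots> = (\<Sum>i<2. (\<integral>\<^sup>+z. ennreal (pair_weight (a + i) (Suc (a + i)) (?B x z) * (Dop \<gamma> (a + i) (Suc (a + i)) f (?B x z))\<^sup>2) \<partial>?M))"
      proof (rule sum.cong[OF refl])
        fix i :: nat assume "i \<in> {..<2}"
        then have i: "i < 2" "i < 3" "Suc i < 3" by auto
        note [measurable] = Dm[OF i(1)]
        have "ennreal (W x) * (\<integral>\<^sup>+z. ennreal ((z i + z (Suc i)) powr m * (Dop \<gamma> i (Suc i) ?g z)\<^sup>2) \<partial>?M) =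
           (\<integral>\<^sup>+z. ennreal (W x) * ennreal ((z i + z (Suc i)) powr m * (Dop \<gamma> i (Suc i) ?g z)\<^sup>2) \<partial>?M)"
          using i by (intro nn_integral_cmult[symmetric]) measurable
        also have "\<dots> = (\<integral>\<^sup>+z. ennreal (pair_weight (a + i) (Suc (a + i)) (?B x z) * (Dop \<gamma> (a + i) (Suc (a + i)) f (?B x z))\<^sup>2) \<partial>?M)"
          by (rule nn_integral_cong) (simp add: D[OF i(1)] w[OF i(1), symmetric] ennreal_mult[symmetric] W0 mult.assoc)
        finally show "ennreal (W x) * (\<integral>\<^sup>+z. ennreal ((z i + z (Suc i)) powr m * (Dop \<gamma> i (Suc i) ?g z)\<^sup>2) \<partial>?M) = \<dots>" .
      qed
      finally show "ennreal (W x) * (kappa \<gamma> m * V x) \<le> \<dots>" .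
    qed
  qed
  also have "\<dots> = (\<Sum>i<2. bond f (a + i))"
  proof -
    have m: "(\<lambda>x. ennreal (pair_weight (a + i) (Suc (a + i)) x * (Dop \<gamma> (a + i) (Suc (a + i)) f x)\<^sup>2)) \<in> borel_measurable (config_space N)" if "i \<in> {..<2}" for i
    proof -
      have i: "a + i < N" "Suc (a + i) < N" using that a by auto
      note [measurable] = measurable_Dop[OF \<gamma> i]
      show ?thesis using i by measurable
    qed
    have m2: "(\<lambda>x. \<integral>\<^sup>+z. ennreal (pair_weight (a + i) (Suc (a + i)) (?B x z) * (Dop \<gamma> (a + i) (Suc (a + i)) f (?B x z))\<^sup>2) \<partial>?M) \<in> borel_measurable \<nu>" if "i \<in> {..<2}" for i
    proof -
      have "(\<lambda>(x, z). ?B x z) \<in> measurable (\<nu> \<Otimes>\<^sub>M ?M) (config_space N)" by measurable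
      from measurable_compose[OF this m[OF that]] show ?thesis
        by (intro n3.borel_measurable_nn_integral) (simp add: split_beta')
    qed
    show ?thesis
      unfolding bond_def wsq_def
      by (rule trans[OF nn_integral_sum[OF m2]], assumption)
        (rule sum.cong[OF refl], rule kernel[symmetric], rule m)
  qed
  also have "\<dots> = bond f a + bond f (Suc a)"
    by (simp add: numeral_2_eq_2 lessThan_Suc add.commute)
  finally show ?thesis unfolding W_def c_def .
qed

text \<open>Same argument as for a transposition, with the average over the three-site block as
  invariant function; \<open>kappa\<close> pays for expressing its distance from \<open>f\<close> by
  the two bonds of the block.\<close>

lemma wsq_rot3_diff_le:
  assumes a: "Suc (Suc a) < N" and [measurable]: "f \<in> borel_measurable (config_space N)"
    and fin: "(\<integral>\<^sup>+x. ennreal ((f x)\<^sup>2) \<partial>\<nu>) < \<infinity>"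
  shows "kappa \<gamma> m * wsq (\<lambda>x. (\<Sum>k<3. x (a + k)) powr m) (\<lambda>x. f (x \<circ> rot3 a) - f x) \<le> 4 * (bond f a + bond f (Suc a))"
proof -
  let ?M = "nu_cond \<gamma> (1/3) 3" and ?b = "(+) a" and ?B = "block_replace 3 ((+) a)"
  let ?W = "\<lambda>x. (\<Sum>k<3. x (a + k)) powr m" and ?c = "\<lambda>x. \<integral>z. f (?B x z) \<partial>?M"
  interpret n3: prob_space ?M using \<gamma> by (intro prob_space_nu_cond) auto
  have b: "inj_on ?b {..<3}" "?b ` {..<3} \<subseteq> {..<N}" using a by auto
  have p3: "rot3 a permutes ?b ` {..<3}"
    by (rule rot3_permutes) (auto simp: image_iff intro: bexI[of _ 0] bexI[of _ 1] bexI[of _ 2])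
  have p: "rot3 a permutes {..<N}" using a by (intro rot3_permutes) auto
  note [measurable] = measurable_block_replace[OF b]
  have ak: "a + k < N" if "k \<in> {..<3}" for k using that a by auto
  have W: "?W \<in> borel_measurable (config_space N)"
  proof -
    have [measurable]: "(\<lambda>x. \<Sum>k<3. x (a + k)) \<in> borel_measurable (config_space N)"
      using ak by (intro borel_measurable_sum) simp
    show ?thesis by measurable
  qed
  have c: "?c \<in> borel_measurable (config_space N)"
    by (rule n3.borel_measurable_lebesgue_integral) measurable
  have "wsq ?W (\<lambda>x. f (x \<circ> rot3 a) - f x) \<le> 4 * wsq ?W (\<lambda>x. f x - ?c x)"
    by (rule wsq_permute_diff_le[OF p W _ c])
      (simp_all add: block_sum_permute[OF b(1) p3, simplified] block_replace_permute[OF b(1) p3])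
  then have "kappa \<gamma> m * wsq ?W (\<lambda>x. f (x \<circ> rot3 a) - f x) \<le> kappa \<gamma> m * (4 * wsq ?W (\<lambda>x. f x - ?c x))"
    by (rule mult_left_mono) simp
  also have "\<dots> = 4 * (kappa \<gamma> m * wsq ?W (\<lambda>x. f x - ?c x))" by (simp add: mult_ac)
  also have "\<dots> \<le> 4 * (bond f a + bond f (Suc a))"
    by (intro mult_left_mono wsq_block_variance a fin) auto
  finally show ?thesis .
qed

end

section \<open>Cost of the transport paths\<close>

context energy_simplex
begin

lemma wsq_telescope_le:
  assumes w0: "\<And>x. 0 \<le> w x" and [measurable]: "w \<in> borel_measurable (config_space N)" "f \<in> borel_measurable (config_space N)"
    and p: "\<And>n. n \<le> L \<Longrightarrow> p n permutes {..<N}"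
  shows "wsq w (\<lambda>x. f (x \<circ> p L) - f (x \<circ> p 0)) \<le> ennreal (real L) * (\<Sum>n<L. wsq w (\<lambda>x. f (x \<circ> p (Suc n)) - f (x \<circ> p n)))"
proof -
  have m: "(\<lambda>x. f (x \<circ> p (Suc n)) - f (x \<circ> p n)) \<in> borel_measurable (config_space N)" if "n < L" for n
  proof -
    have "p n permutes {..<N}" "p (Suc n) permutes {..<N}" using p that by auto
    note [measurable] = this[THEN measurable_permuted]
    show ?thesis by measurable
  qed
  have "wsq w (\<lambda>x. f (x \<circ> p L) - f (x \<circ> p 0)) = wsq w (\<lambda>x. \<Sum>n<L. f (x \<circ> p (Suc n)) - f (x \<circ> p n))"
    by (simp add: sum_lessThan_telescope[of "\<lambda>n. f (_ \<circ> p n)"])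
  also have "\<dots> \<le> ennreal (real L) * (\<Sum>n<L. wsq w (\<lambda>x. f (x \<circ> p (Suc n)) - f (x \<circ> p n)))"
    by (rule wsq_sum[OF w0 _ m]) measurable
  finally show ?thesis .
qed

text \<open>By \<open>le\<close>, after \<open>p n\<close> has acted the rate of the next bond
  dominates \<open>w\<close>, and exchangeability then strips off \<open>p n\<close>. Cauchy-Schwarz
  costs the length \<open>L \<le> N\<close>, while injectivity of \<open>r\<close> keeps the sum of
  bonds below one Dirichlet form.\<close>

lemma wsq_path_le:
  assumes w0: "\<And>x. 0 \<le> w x" and w[measurable]: "w \<in> borel_measurable (config_space N)" and f[measurable]: "f \<in> borel_measurable (config_space N)"
    and p: "\<And>n. n \<le> L \<Longrightarrow> p n permutes {..<N}" and p0: "p 0 = id" and L: "L \<le> N"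
    and r: "inj_on r {..<L}" "\<And>n. n < L \<Longrightarrow> Suc (r n) < N"
    and step: "\<And>n. n < L \<Longrightarrow> p (Suc n) = p n \<circ> Transposition.transpose (r n) (Suc (r n))"
    and le: "\<And>n. n < L \<Longrightarrow> AE x in \<nu>. w x \<le> pair_weight (r n) (Suc (r n)) (x \<circ> p n)"
  shows "wsq w (\<lambda>x. f (x \<circ> p L) - f x) \<le> ennreal (4 * real N) * dirichlet_nn \<gamma> m E N f"
proof -
  have s: "wsq w (\<lambda>x. f (x \<circ> p (Suc n)) - f (x \<circ> p n)) \<le> 4 * bond f (r n)" if n: "n < L" for n
  proof -
    let ?t = "Transposition.transpose (r n) (Suc (r n))"
    have rn: "r n < N" "Suc (r n) < N" "r n \<noteq> Suc (r n)" using r(2)[OF n] by auto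
    have "?t permutes {..<N}" using rn by (intro permutes_swap_id) auto
    note [measurable] = measurable_permuted[OF this]
    have "wsq w (\<lambda>x. f (x \<circ> p (Suc n)) - f (x \<circ> p n)) = wsq w (\<lambda>x. f ((x \<circ> p n) \<circ> ?t) - f (x \<circ> p n))"
      by (simp only: step[OF n] comp_assoc)
    also have "\<dots> \<le> wsq (pair_weight (r n) (Suc (r n))) (\<lambda>x. f (x \<circ> ?t) - f x)"
      using n rn by (intro wsq_permute_le[of _ "pair_weight (r n) (Suc (r n))" "\<lambda>x. f (x \<circ> ?t) - f x"] p le) auto
    also have "\<dots> \<le> 4 * bond f (r n)"
      unfolding bond_def by (rule wsq_transpose_diff_le[OF rn f])
    finally show ?thesis .
  qed
  have "wsq w (\<lambda>x. f (x \<circ> p L) - f (x \<circ> p 0)) \<le> ennreal (real L) * (\<Sum>n<L. wsq w (\<lambda>x. f (x \<circ> p (Suc n)) - f (x \<circ> p n)))"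
    by (rule wsq_telescope_le[OF w0 w f p])
  also have "\<dots> \<le> ennreal (real N) * (\<Sum>n<L. 4 * bond f (r n))"
    using L s by (intro mult_mono sum_mono ennreal_leI) auto
  also have "\<dots> = ennreal (4 * real N) * (\<Sum>n<L. bond f (r n))"
    by (simp add: sum_distrib_left[symmetric] ennreal_mult mult_ac)
  also have "\<dots> \<le> ennreal (4 * real N) * dirichlet_nn \<gamma> m E N f"
    by (intro mult_left_mono sum_bond_le r) auto
  finally show ?thesis by (simp add: p0)
qed

lemma powr_le_pair_weight: "0 < u \<Longrightarrow> 0 < v \<Longrightarrow> u powr m \<le> (u + v) powr m" "0 < u \<Longrightarrow> 0 < v \<Longrightarrow> v powr m \<le> (u + v) powr m"
  using m by (auto intro!: powr_mono2)

text \<open>After \<open>n\<close> steps the energy of site \<open>i\<close> sits at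
  \<open>i + n\<close>, an endpoint of the bond used next, so its power is at most the rate
  there.\<close>

lemma wsq_carry_up_le:
  assumes ik: "i \<le> k" "Suc k < N" and f: "f \<in> borel_measurable (config_space N)"
  shows "wsq (\<lambda>x. x i powr m) (\<lambda>x. f (x \<circ> carry_up i k) - f x) \<le> ennreal (4 * real N) * dirichlet_nn \<gamma> m E N f"
proof -
  have "wsq (\<lambda>x. x i powr m) (\<lambda>x. f (x \<circ> carry_up i (i + (k - i))) - f x) \<le> ennreal (4 * real N) * dirichlet_nn \<gamma> m E N f"
  proof (rule wsq_path_le[where p = "\<lambda>n. carry_up i (i + n)" and r = "\<lambda>n. i + n", OF _ _ f])
    show "AE x in \<nu>. x i powr m \<le> pair_weight (i + n) (Suc (i + n)) (x \<circ> carry_up i (i + n))" if "n < k - i" for n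
      using AE_simplex by (rule eventually_mono) (use ik that in \<open>auto simp: carry_up_def intro!: powr_le_pair_weight\<close>)
    have "i < N" using ik by simp
    then show "(\<lambda>x. x i powr m) \<in> borel_measurable (config_space N)" by measurable
  qed (use ik in \<open>auto simp: carry_up_self carry_up_Suc intro: permutes_carry_up\<close>)
  then show ?thesis using ik by simp
qed

lemma wsq_carry_down_le:
  assumes ij: "i < j" "j < N" and f: "f \<in> borel_measurable (config_space N)"
  shows "wsq (\<lambda>x. x j powr m) (\<lambda>x. f (x \<circ> carry_down j (Suc i)) - f x) \<le> ennreal (4 * real N) * dirichlet_nn \<gamma> m E N f"
proof -
  have "wsq (\<lambda>x. x j powr m) (\<lambda>x. f (x \<circ> carry_down j (j - (j - Suc i))) - f x) \<le> ennreal (4 * real N) * dirichlet_nn \<gamma> m E N f"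
  proof (rule wsq_path_le[where p = "\<lambda>n. carry_down j (j - n)" and r = "\<lambda>n. j - Suc n", OF _ _ f])
    fix n assume n: "n < j - Suc i"
    \<comment> \<open>The path runs downwards: step \<open>n\<close> uses the bond
      \<open>j - Suc n\<close>, whose upper end \<open>j - n\<close> carries the energy of
      \<open>j\<close>. The bound on \<open>n\<close> keeps the truncated subtraction exact.\<close>
    have e: "Suc (j - Suc n) = j - n" using n by simp
    show "carry_down j (j - Suc n) = carry_down j (j - n) \<circ> Transposition.transpose (j - Suc n) (Suc (j - Suc n))"
      using carry_down_Suc[of "j - Suc n" j] n by (simp add: e)
    have lt: "j - Suc n < N" using ij by simp
    show "AE x in \<nu>. x j powr m \<le> pair_weight (j - Suc n) (Suc (j - Suc n)) (x \<circ> carry_down j (j - n))"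
      using AE_simplex by (rule eventually_mono) (use ij n lt in \<open>auto simp: carry_down_def e intro!: powr_le_pair_weight\<close>)
    show "Suc (j - Suc n) < N" using ij n by simp
  next
    show "(\<lambda>x. x j powr m) \<in> borel_measurable (config_space N)" using ij by measurable
    show "inj_on (\<lambda>n. j - Suc n) {..<j - Suc i}" by (auto simp: inj_on_def)
  qed (use ij in \<open>auto simp: carry_down_self intro: permutes_carry_down\<close>)
  then show ?thesis using ij by simp
qed

text \<open>The energy of \<open>Suc k\<close> sits in the middle of each rotated block, so the
  block weight dominates it. Consecutive blocks overlap and a bond lies in at most two of them,
  which gives 8 instead of 4.\<close>

lemma wsq_carry_pair_le:
  assumes ik: "i \<le> k" "Suc k < N" and f[measurable]: "f \<in> borel_measurable (config_space N)"
    and fin: "(\<integral>\<^sup>+x. ennreal ((f x)\<^sup>2) \<partial>\<nu>) < \<infinity>"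
  shows "kappa \<gamma> m * wsq (\<lambda>x. x (Suc k) powr m) (\<lambda>x. f (x \<circ> carry_pair i (Suc k) k) - f (x \<circ> carry_pair i (Suc k) i))
    \<le> ennreal (8 * real N) * dirichlet_nn \<gamma> m E N f"
proof -
  let ?w = "\<lambda>x. x (Suc k) powr m :: real" and ?j = "Suc k"
  define L where "L = k - i"
  define p where "p n = carry_pair i ?j (i + n)" for n
  have p: "p n permutes {..<N}" if "n \<le> L" for n
    unfolding p_def using that ik by (intro permutes_carry_pair) (auto simp: L_def)
  have w: "?w \<in> borel_measurable (config_space N)" using ik by measurable
  let ?D = "dirichlet_nn \<gamma> m E N f"
  have s: "kappa \<gamma> m * wsq ?w (\<lambda>x. f (x \<circ> p (Suc n)) - f (x \<circ> p n)) \<le> 4 * (bond f (i + n) + bond f (Suc (i + n)))" if n: "n < L" for n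
  proof -
    have a: "Suc (Suc (i + n)) < N" using n ik by (simp add: L_def)
    let ?W = "\<lambda>x. (\<Sum>l<3. x (i + n + l)) powr m :: real"
    have "rot3 (i + n) permutes {..<N}" using a by (intro rot3_permutes) auto
    note [measurable] = measurable_permuted[OF this]
    have [measurable]: "(\<lambda>x. \<Sum>l<3. x (i + n + l)) \<in> borel_measurable (config_space N)"
      using a by (intro borel_measurable_sum) simp
    have "wsq ?w (\<lambda>x. f (x \<circ> p (Suc n)) - f (x \<circ> p n)) = wsq ?w (\<lambda>x. f ((x \<circ> p n) \<circ> rot3 (i + n)) - f (x \<circ> p n))"
      using n carry_pair_Suc[of i "i + n" ?j] by (simp add: p_def L_def comp_assoc)
    also have "\<dots> \<le> wsq ?W (\<lambda>x. f (x \<circ> rot3 (i + n)) - f x)"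
    proof (rule wsq_permute_le[of _ ?W "\<lambda>x. f (x \<circ> rot3 (i + n)) - f x"])
      show "p n permutes {..<N}" using n by (intro p) simp
      show "AE x in \<nu>. ?w x \<le> ?W (x \<circ> p n)"
        using AE_simplex
      proof (rule eventually_mono)
        fix x :: "nat \<Rightarrow> real" assume x: "(\<forall>i<N. 0 < x i) \<and> (\<Sum>i<N. x i) = real N * E"
        have pl: "p n l < N" if "l < N" for l using permutes_in_image[OF p, of n l] n that by simp
        have "p n (Suc (i + n)) = ?j" by (simp add: p_def carry_pair_def)
        then have "(\<Sum>l<3. (x \<circ> p n) (i + n + l)) = x (p n (i + n)) + x ?j + x (p n (Suc (Suc (i + n))))"
          by (simp add: numeral_3_eq_3)
        moreover have "0 < x (p n (i + n))" "0 < x ?j" "0 < x (p n (Suc (Suc (i + n))))"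
          using x pl a ik by auto
        ultimately show "?w x \<le> ?W (x \<circ> p n)"
          using m by (intro powr_mono2) auto
      qed
    qed measurable
    finally have "kappa \<gamma> m * wsq ?w (\<lambda>x. f (x \<circ> p (Suc n)) - f (x \<circ> p n)) \<le> kappa \<gamma> m * wsq ?W (\<lambda>x. f (x \<circ> rot3 (i + n)) - f x)"
      by (rule mult_left_mono) simp
    also have "\<dots> \<le> 4 * (bond f (i + n) + bond f (Suc (i + n)))"
      by (rule wsq_rot3_diff_le[OF a f fin])
    finally show ?thesis .
  qed
  have b1: "(\<Sum>n<L. bond f (i + n)) \<le> ?D"
    using ik by (intro sum_bond_le) (auto simp: L_def)
  have b2: "(\<Sum>n<L. bond f (Suc (i + n))) \<le> ?D"
    using ik by (intro sum_bond_le) (auto simp: L_def inj_on_def)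
  have "kappa \<gamma> m * wsq ?w (\<lambda>x. f (x \<circ> p L) - f (x \<circ> p 0)) \<le> kappa \<gamma> m * (ennreal (real L) * (\<Sum>n<L. wsq ?w (\<lambda>x. f (x \<circ> p (Suc n)) - f (x \<circ> p n))))"
    by (intro mult_left_mono wsq_telescope_le p w f) auto
  also have "\<dots> = ennreal (real L) * (\<Sum>n<L. kappa \<gamma> m * wsq ?w (\<lambda>x. f (x \<circ> p (Suc n)) - f (x \<circ> p n)))"
    by (simp add: sum_distrib_left mult_ac)
  also have "\<dots> \<le> ennreal (real N) * (\<Sum>n<L. 4 * (bond f (i + n) + bond f (Suc (i + n))))"
  proof (rule mult_mono)
    show "ennreal (real L) \<le> ennreal (real N)" using ik by (intro ennreal_leI) (simp add: L_def)
    show "(\<Sum>n<L. kappa \<gamma> m * wsq ?w (\<lambda>x. f (x \<circ> p (Suc n)) - f (x \<circ> p n))) \<le> (\<Sum>n<L. 4 * (bond f (i + n) + bond f (Suc (i + n))))"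
      by (rule sum_mono, rule s) simp
  qed simp_all
  also have "\<dots> = ennreal (real N) * (4 * ((\<Sum>n<L. bond f (i + n)) + (\<Sum>n<L. bond f (Suc (i + n)))))"
    by (simp add: sum_distrib_left[symmetric] sum.distrib)
  also have "\<dots> \<le> ennreal (real N) * (4 * (?D + ?D))"
    by (intro mult_left_mono add_mono b1 b2) auto
  also have "\<dots> = ennreal (8 * real N) * ?D"
    by (simp add: mult_2[symmetric] ennreal_mult mult_ac)
  finally show ?thesis using ik by (simp add: p_def L_def)
qed

text \<open>With \<open>h\<close> as comparison function, the weight of \<open>i\<close> costs
  \<open>2 * (4 * N + 1)\<close>, to be multiplied by \<open>K\<close>. The weight of
  \<open>j\<close> costs \<open>3 * (4 * N + 1)\<close> times \<open>K\<close> for the ends of the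
  path and \<open>3 * 8 * N\<close> for the rotations, which have already used up
  \<open>kappa\<close>.\<close>

lemma wsq_Dop_long_range:
  assumes ij: "i < j" "j < N" and f[measurable]: "f \<in> borel_measurable (config_space N)"
    and fin: "(\<integral>\<^sup>+x. ennreal ((f x)\<^sup>2) \<partial>\<nu>) < \<infinity>" and K: "kappa \<gamma> m \<le> ennreal K" "K \<ge> 0"
  shows "kappa \<gamma> m * wsq (pair_weight i j) (Dop \<gamma> i j f) \<le> ennreal (2 powr m * (25 * K + 24) * real N) * dirichlet_nn \<gamma> m E N f"
proof -
  obtain k where k: "j = Suc k" "i \<le> k" using ij by (cases j) auto
  have kN: "Suc k < N" "k < N" "i < N" using ij k by auto
  let ?D = "dirichlet_nn \<gamma> m E N f" and ?\<kappa> = "kappa \<gamma> m"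
  let ?u = "carry_up i k" and ?wi = "\<lambda>x. x i powr m :: real" and ?wj = "\<lambda>x. x (Suc k) powr m :: real"
  have u: "?u permutes {..<N}" using k kN by (intro permutes_carry_up) auto
  note [measurable] = measurable_permuted[OF u] measurable_Eop[OF \<gamma> kN(2,1)] measurable_Dop[OF \<gamma> kN(2,1)]
  have d: "carry_down j (Suc i) permutes {..<N}" using ij by (intro permutes_carry_down) auto
  note [measurable] = measurable_permuted[OF d]
  have uk: "?u k = i" "?u (Suc k) = Suc k" "k < ?u l \<and> l \<noteq> Suc k \<Longrightarrow> ?u l \<noteq> i" for l
    using k by (auto simp: carry_up_def)
  define h where "h x = Eop \<gamma> k (Suc k) f (x \<circ> ?u)" for x
  have [measurable]: "h \<in> borel_measurable (config_space N)" unfolding h_def[abs_def] by measurable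
  have wi: "?wi \<in> borel_measurable (config_space N)" and wj: "?wj \<in> borel_measurable (config_space N)"
    using kN by measurable
  \<comment> \<open>\<open>carry_up\<close> maps the positions \<open>k\<close> and
    \<open>Suc k\<close> to \<open>i\<close> and \<open>j\<close>, so an exchange between the
    distant sites becomes one across a single bond after the transport. This is why \<open>h\<close>
    is invariant.\<close>
  have T: "Tmove i j a x \<circ> ?u = Tmove k (Suc k) a (x \<circ> ?u)" for a x
    using k by (auto simp: fun_eq_iff Tmove_def carry_up_def)
  have h: "h (Tmove i j a x) = h x" for a x
    by (simp add: h_def T Eop_Tmove)
  \<comment> \<open>Averaging at the end of the transport costs one bond. Pulled back, its rate is
    \<open>(x i + x j) powr m\<close>, which dominates either of the two weights.\<close>
  have last: "wsq w (\<lambda>x. Dop \<gamma> k (Suc k) f (x \<circ> ?u)) \<le> ?D"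
    if "AE x in \<nu>. w x \<le> (x i + x (Suc k)) powr m" for w
  proof -
    have "wsq w (\<lambda>x. Dop \<gamma> k (Suc k) f (x \<circ> ?u)) \<le> bond f k"
      unfolding bond_def using that kN by (intro wsq_permute_le u) (auto simp: uk)
    also have "\<dots> \<le> ?D" by (rule bond_le[OF kN(1)])
    finally show ?thesis .
  qed
  have li: "wsq ?wi (\<lambda>x. Dop \<gamma> k (Suc k) f (x \<circ> ?u)) \<le> ?D"
    by (rule last, rule eventually_mono[OF AE_simplex]) (use kN in \<open>auto intro!: powr_le_pair_weight\<close>)
  have lj: "wsq ?wj (\<lambda>x. Dop \<gamma> k (Suc k) f (x \<circ> ?u)) \<le> ?D"
    by (rule last, rule eventually_mono[OF AE_simplex]) (use kN in \<open>auto intro!: powr_le_pair_weight\<close>)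
  have A: "wsq ?wi (\<lambda>x. h x - f x) \<le> ennreal (8 * real N + 2) * ?D"
  proof -
    have "wsq ?wi (\<lambda>x. h x - f x) = wsq ?wi (\<lambda>x. (f (x \<circ> ?u) - f x) + Dop \<gamma> k (Suc k) f (x \<circ> ?u))"
      by (simp add: h_def Dop_def)
    also have "\<dots> \<le> 2 * (wsq ?wi (\<lambda>x. f (x \<circ> ?u) - f x) + wsq ?wi (\<lambda>x. Dop \<gamma> k (Suc k) f (x \<circ> ?u)))"
      by (rule wsq_add[OF _ wi]) (simp, measurable)
    also have "\<dots> \<le> 2 * (ennreal (4 * real N) * ?D + ?D)"
      by (intro mult_left_mono add_mono wsq_carry_up_le li k kN f) auto
    also have "\<dots> = ennreal (8 * real N + 2) * ?D"
      by (simp add: distrib_left distrib_right ennreal_plus ennreal_mult mult.assoc[symmetric])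
    finally show ?thesis .
  qed
  let ?P = "\<lambda>x. f (x \<circ> carry_pair i (Suc k) k) - f (x \<circ> carry_pair i (Suc k) i)"
  have B: "?\<kappa> * wsq ?wj (\<lambda>x. h x - f x) \<le> ennreal (K * (12 * real N + 3) + 24 * real N) * ?D"
  proof -
    have ends: "carry_pair i (Suc k) k = ?u" "carry_pair i (Suc k) i = carry_down j (Suc i)"
      using k ij carry_pair_start[of i j] by (auto simp: carry_pair_end)
    have "wsq ?wj (\<lambda>x. h x - f x) = wsq ?wj (\<lambda>x. (f (x \<circ> carry_down j (Suc i)) - f x) + ?P x + Dop \<gamma> k (Suc k) f (x \<circ> ?u))"
      by (simp add: h_def Dop_def ends)
    also have "\<dots> \<le> 3 * (wsq ?wj (\<lambda>x. f (x \<circ> carry_down j (Suc i)) - f x) + wsq ?wj ?P + wsq ?wj (\<lambda>x. Dop \<gamma> k (Suc k) f (x \<circ> ?u)))"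
      unfolding ends by (rule wsq_add3[OF _ wj]) (simp, measurable)
    also have "\<dots> \<le> 3 * (ennreal (4 * real N) * ?D + wsq ?wj ?P + ?D)"
      using wsq_carry_down_le[OF ij f] lj k by (intro mult_left_mono add_mono) auto
    finally have "?\<kappa> * wsq ?wj (\<lambda>x. h x - f x) \<le> ?\<kappa> * (3 * (ennreal (4 * real N) * ?D + wsq ?wj ?P + ?D))"
      by (rule mult_left_mono) simp
    also have "\<dots> = ?\<kappa> * (3 * (ennreal (4 * real N) * ?D + ?D)) + 3 * (?\<kappa> * wsq ?wj ?P)"
      by (simp add: distrib_left mult_ac add_ac)
    also have "\<dots> \<le> ennreal K * (3 * (ennreal (4 * real N) * ?D + ?D)) + 3 * (ennreal (8 * real N) * ?D)"
      by (intro add_mono mult_mono wsq_carry_pair_le k kN f fin K) auto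
    also have "\<dots> = ennreal (K * (12 * real N + 3) + 24 * real N) * ?D"
      using K(2) by (simp add: distrib_left distrib_right ennreal_plus ennreal_mult mult.assoc[symmetric])
    finally show ?thesis .
  qed
  have pw: "pair_weight i j \<in> borel_measurable (config_space N)" using kN ij by measurable
  have "wsq (pair_weight i j) (Dop \<gamma> i j f) \<le> wsq (pair_weight i j) (\<lambda>x. f x - h x)"
    using ij pw by (intro wsq_Dop_le) (auto simp: h)
  also have "\<dots> = wsq (pair_weight i j) (\<lambda>x. h x - f x)" by (rule wsq_minus)
  also have "\<dots> \<le> ennreal (2 powr m) * (wsq ?wi (\<lambda>x. h x - f x) + wsq ?wj (\<lambda>x. h x - f x))"
  proof -
    have "wsq (pair_weight i j) (\<lambda>x. h x - f x) \<le>
      (\<integral>\<^sup>+x. ennreal (2 powr m) * (ennreal (?wi x * (h x - f x)\<^sup>2) + ennreal (?wj x * (h x - f x)\<^sup>2)) \<partial>\<nu>)"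
      unfolding wsq_def
    proof (rule nn_integral_mono_AE, rule eventually_mono[OF AE_simplex])
      fix x :: "nat \<Rightarrow> real" assume x: "(\<forall>i<N. 0 < x i) \<and> (\<Sum>i<N. x i) = real N * E"
      then have pos: "0 < x i" "0 < x (Suc k)" using kN by auto
      \<comment> \<open>The sum is at most twice the maximum, and the power of the maximum is one of
        the two powers; this also covers \<open>m < 1\<close>.\<close>
      have "(x i + x (Suc k)) powr m \<le> (2 * max (x i) (x (Suc k))) powr m"
        using pos m by (intro powr_mono2) auto
      also have "\<dots> = 2 powr m * max (x i) (x (Suc k)) powr m" by (rule powr_mult)
      also have "\<dots> \<le> 2 powr m * (?wi x + ?wj x)"
        by (intro mult_left_mono) (auto simp: max_def)
      finally have "pair_weight i j x * (h x - f x)\<^sup>2 \<le> 2 powr m * (?wi x + ?wj x) * (h x - f x)\<^sup>2"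
        unfolding k(1) by (intro mult_right_mono) auto
      then have "ennreal (pair_weight i j x * (h x - f x)\<^sup>2) \<le> ennreal (2 powr m * (?wi x * (h x - f x)\<^sup>2 + ?wj x * (h x - f x)\<^sup>2))"
        by (intro ennreal_leI) (simp add: algebra_simps)
      then show "ennreal (pair_weight i j x * (h x - f x)\<^sup>2) \<le>
        ennreal (2 powr m) * (ennreal (?wi x * (h x - f x)\<^sup>2) + ennreal (?wj x * (h x - f x)\<^sup>2))"
        by (simp add: ennreal_mult ennreal_plus)
    qed
    also have "\<dots> = ennreal (2 powr m) * (wsq ?wi (\<lambda>x. h x - f x) + wsq ?wj (\<lambda>x. h x - f x))"
      unfolding wsq_def using wi wj by (simp add: nn_integral_cmult nn_integral_add)
    finally show ?thesis .
  qed
  finally have "?\<kappa> * wsq (pair_weight i j) (Dop \<gamma> i j f) \<le> ?\<kappa> * (ennreal (2 powr m) * (wsq ?wi (\<lambda>x. h x - f x) + wsq ?wj (\<lambda>x. h x - f x)))"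
    by (rule mult_left_mono) simp
  also have "\<dots> = ennreal (2 powr m) * (?\<kappa> * wsq ?wi (\<lambda>x. h x - f x) + ?\<kappa> * wsq ?wj (\<lambda>x. h x - f x))"
    by (simp add: distrib_left mult_ac)
  also have "\<dots> \<le> ennreal (2 powr m) * (ennreal K * (ennreal (8 * real N + 2) * ?D) + ennreal (K * (12 * real N + 3) + 24 * real N) * ?D)"
    by (intro mult_left_mono add_mono B mult_mono[OF K(1) A]) auto
  also have "\<dots> = ennreal (2 powr m * (K * (20 * real N + 5) + 24 * real N)) * ?D"
  proof -
    have "ennreal (2 powr m * (K * (20 * real N + 5) + 24 * real N)) =
      ennreal (2 powr m) * (ennreal K * ennreal (8 * real N + 2) + ennreal (K * (12 * real N + 3) + 24 * real N))"
      using K(2) by (simp add: ennreal_mult[symmetric] ennreal_plus[symmetric] algebra_simps del: ennreal_plus)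
    then show ?thesis by (simp add: distrib_right distrib_left mult.assoc)
  qed
  also have "\<dots> \<le> ennreal (2 powr m * (25 * K + 24) * real N) * ?D"
  proof (intro mult_right_mono ennreal_leI)
    \<comment> \<open>The terms free of \<open>N\<close> are absorbed using
      \<open>N \<ge> 1\<close>; this turns \<open>20 + 5\<close> into the 25 of the
      constant.\<close>
    have "K * 5 \<le> K * (5 * real N)" using K(2) N by (intro mult_left_mono) auto
    then have "K * (20 * real N + 5) + 24 * real N \<le> (25 * K + 24) * real N" by (simp add: algebra_simps)
    then show "2 powr m * (K * (20 * real N + 5) + 24 * real N) \<le> 2 powr m * (25 * K + 24) * real N"
      by (simp add: mult.assoc)
  qed simp
  finally show ?thesis .
qed

text \<open>Fewer than \<open>N^2\<close> pairs, each costing a multiple of \<open>N\<close>,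
  against the prefactor \<open>1 / N\<close> of the long-range form.\<close>

lemma kappa_dirichlet_lr_le:
  assumes f: "f \<in> borel_measurable (config_space N)"
    and fin: "(\<integral>\<^sup>+x. ennreal ((f x)\<^sup>2) \<partial>\<nu>) < \<infinity>" and K: "kappa \<gamma> m \<le> ennreal K" "K \<ge> 0"
  shows "kappa \<gamma> m * dirichlet_lr \<gamma> m E N f \<le> ennreal (2 powr m * (25 * K + 24) * (real N)\<^sup>2) * dirichlet_nn \<gamma> m E N f"
proof -
  let ?S = "{(i, j). i < j \<and> j < N}" and ?D = "dirichlet_nn \<gamma> m E N f"
  define c where "c = 2 powr m * (25 * K + 24)"
  have c: "c \<ge> 0" using K(2) by (simp add: c_def)
  have S: "?S \<subseteq> {..<N} \<times> {..<N}" by auto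
  have cS: "real (card ?S) \<le> real N * real N"
    using card_mono[OF _ S] by (simp add: card_cartesian_product of_nat_mult[symmetric] del: of_nat_mult)
  have "kappa \<gamma> m * dirichlet_lr \<gamma> m E N f = ennreal (1 / real N) * (\<Sum>(i, j)\<in>?S. kappa \<gamma> m * wsq (pair_weight i j) (Dop \<gamma> i j f))"
    by (simp add: dirichlet_lr_def wsq_def sum_distrib_left split_beta' mult_ac)
  also have "\<dots> \<le> ennreal (1 / real N) * (\<Sum>(i, j)\<in>?S. ennreal (c * real N) * ?D)"
    using wsq_Dop_long_range[OF _ _ f fin K] unfolding c_def by (intro mult_left_mono sum_mono) auto
  also have "\<dots> = ennreal (1 / real N) * (ennreal (real (card ?S)) * (ennreal (c * real N) * ?D))"
    by (simp add: split_beta' ennreal_of_nat_eq_real_of_nat)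
  also have "\<dots> \<le> ennreal (1 / real N) * (ennreal (real N * real N) * (ennreal (c * real N) * ?D))"
    using cS by (intro mult_left_mono mult_right_mono ennreal_leI) auto
  also have "\<dots> = ennreal (1 / real N * (real N * real N) * (c * real N)) * ?D"
  proof -
    have "ennreal (1 / real N * (real N * real N) * (c * real N)) = ennreal (1 / real N) * ennreal (real N * real N) * ennreal (c * real N)"
      using c by (simp only: ennreal_mult mult_nonneg_nonneg of_nat_0_le_iff divide_nonneg_nonneg zero_le_one)
    then show ?thesis by (simp only: mult.assoc)
  qed
  also have "1 / real N * (real N * real N) * (c * real N) = c * (real N)\<^sup>2"
    using N by (simp add: power2_eq_square)
  finally show ?thesis unfolding c_def .
qed

end

section \<open>Finiteness of \<open>kappa\<close> and comparison of the gaps\<close>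

lemma kappa_finite:
  assumes \<gamma>: "\<gamma> > 0" and m: "m \<ge> 0"
  shows "kappa \<gamma> m < \<top>"
proof -
  interpret s: energy_simplex \<gamma> m "1/3" 3 using assms by unfold_locales auto
  let ?M = "nu_cond \<gamma> (1/3) 3"
  have AE: "AE x in ?M. (\<forall>i<3. 0 < x i) \<and> (\<Sum>i<3. x i) = 1"
    using s.AE_simplex by simp
  define c where "c = (\<integral>x. x 0 \<partial>?M)"
  \<comment> \<open>An infimum over no test functions would be \<top>, so an admissible one with
    finite form has to be exhibited: the centred energy of a single site.\<close>
  define f where "f x = x 0 - c" for x :: "nat \<Rightarrow> real"
  have x0[measurable]: "(\<lambda>x. x 0) \<in> borel_measurable (config_space 3)" by measurable
  have f[measurable]: "f \<in> borel_measurable (config_space 3)" unfolding f_def by measurable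
  have b: "AE x in ?M. \<bar>x 0\<bar> \<le> 1"
    using AE
  proof (rule eventually_mono)
    fix x :: "nat \<Rightarrow> real" assume x: "(\<forall>i<3. 0 < x i) \<and> (\<Sum>i<3. x i) = 1"
    then have "0 < x 0" "0 < x (Suc 0)" "0 < x (Suc (Suc 0))" by auto
    moreover have "x 0 + x (Suc 0) + x (Suc (Suc 0)) = 1" using x by (simp add: numeral_3_eq_3)
    ultimately show "\<bar>x 0\<bar> \<le> 1" by linarith
  qed
  have i1: "integrable ?M (\<lambda>x. x 0)"
    using b by (intro s.nu.integrable_const_bound[where B=1]) auto
  have "AE x in ?M. \<bar>(f x)\<^sup>2\<bar> \<le> (1 + \<bar>c\<bar>)\<^sup>2"
    using b by (rule eventually_mono) (auto simp: f_def intro!: power2_le_iff_abs_le[THEN iffD2])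
  then have i2: "integrable ?M (\<lambda>x. (f x)\<^sup>2)"
    by (intro s.nu.integrable_const_bound[where B="(1 + \<bar>c\<bar>)\<^sup>2"]) auto
  have f0: "(\<integral>x. f x \<partial>?M) = 0"
    unfolding f_def using i1 by (simp add: c_def s.nu.prob_space[unfolded space_nu_cond])
  \<comment> \<open>If the centred energy vanished almost surely, it would still vanish after
    resampling sites 0 and 1. The Beta proportion would then be a single number for almost every
    \<open>x\<close>, although its law has a density.\<close>
  have nz: "(\<integral>x. (f x)\<^sup>2 \<partial>?M) \<noteq> 0"
  proof
    assume "(\<integral>x. (f x)\<^sup>2 \<partial>?M) = 0"
    then have "AE x in ?M. (f x)\<^sup>2 = 0"
      using integral_nonneg_eq_0_iff_AE[OF i2] by simp
    then have "(\<integral>\<^sup>+x. ennreal ((f x)\<^sup>2) \<partial>?M) = 0"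
      by (subst nn_integral_0_iff_AE) auto
    then have "(\<integral>\<^sup>+x. (\<integral>\<^sup>+a. ennreal ((f (Tmove 0 1 a x))\<^sup>2) \<partial>beta_sym \<gamma>) \<partial>?M) = 0"
      by (subst nn_integral_nu_cond_Tmove[OF \<gamma>, symmetric]) auto
    moreover have "(\<lambda>x. \<integral>\<^sup>+a. ennreal ((f (Tmove 0 1 a x))\<^sup>2) \<partial>beta_sym \<gamma>) \<in> borel_measurable ?M"
    proof -
      have [measurable]: "(\<lambda>(x, a). Tmove 0 1 a x) \<in> measurable (?M \<Otimes>\<^sub>M beta_sym \<gamma>) (config_space 3)"
        unfolding split_beta' by (intro measurable_Tmove) auto
      show ?thesis by (intro s.beta.borel_measurable_nn_integral) measurable
    qed
    ultimately have "AE x in ?M. (\<integral>\<^sup>+a. ennreal ((f (Tmove 0 1 a x))\<^sup>2) \<partial>beta_sym \<gamma>) = 0"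
      by (subst (asm) nn_integral_0_iff_AE) auto
    then have "AE x in ?M. False"
      using AE AE_space
    proof eventually_elim
      fix x assume z: "(\<integral>\<^sup>+a. ennreal ((f (Tmove 0 1 a x))\<^sup>2) \<partial>beta_sym \<gamma>) = 0"
        and x: "(\<forall>i<3. 0 < x i) \<and> (\<Sum>i<3. x i) = 1" and "x \<in> space ?M"
      then have "(\<lambda>a. Tmove 0 1 a x) \<in> measurable borel (config_space 3)"
        by (intro measurable_Tmove) auto
      from measurable_compose[OF this, of "\<lambda>y. ennreal ((f y)\<^sup>2)" borel]
      have m: "(\<lambda>a. ennreal ((f (Tmove 0 1 a x))\<^sup>2)) \<in> borel_measurable (beta_sym \<gamma>)"
        unfolding measurable_cong_sets[OF sets_beta_sym refl] by simp
      have pos: "x 0 + x 1 > 0" using x by (simp add: add_pos_pos)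
      have "AE a in beta_sym \<gamma>. ennreal ((f (Tmove 0 1 a x))\<^sup>2) = 0"
        using z nn_integral_0_iff_AE[OF m] by (simp only:)
      then have "AE a in beta_sym \<gamma>. a = c / (x 0 + x 1)"
        by (rule eventually_mono) (use pos in \<open>auto simp: f_def Tmove_def field_simps\<close>)
      moreover have "AE a in beta_sym \<gamma>. a \<noteq> c / (x 0 + x 1)"
      proof -
        have "AE a in lborel. a \<noteq> c / (x 0 + x 1)" by (rule AE_lborel_singleton)
        then show ?thesis unfolding beta_sym_def
          by (subst AE_density) (auto elim: eventually_mono)
      qed
      ultimately have "AE a in beta_sym \<gamma>. False" by eventually_elim simp
      then show False by (simp add: s.beta.AE_False)
    qed
    then show False by (simp add: s.nu.AE_False)
  qed
  have "f \<in> test_fns \<gamma> (1/3) 3" using i2 f0 nz by (simp add: test_fns_def)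
  then have "kappa \<gamma> m \<le> dirichlet_nn \<gamma> m (1/3) 3 f / ennreal (\<integral>x. (f x)\<^sup>2 \<partial>?M)"
    unfolding kappa_def gap_nn_def by (rule INF_lower)
  also have "\<dots> < \<top>"
  proof -
    have "s.bond f i < \<top>" if i: "i < 2" for i
    proof -
      \<comment> \<open>Comparison with \<open>h = 0\<close>: a bond is at most the weighted norm of
        \<open>f\<close>, and on the simplex of sum one the weights are at most one because
        \<open>m \<ge> 0\<close>.\<close>
      have "s.bond f i \<le> s.wsq (s.pair_weight i (Suc i)) (\<lambda>x. f x - 0)"
        unfolding s.bond_def using i by (intro s.wsq_Dop_le) auto
      also have "\<dots> \<le> s.wsq (\<lambda>_. 1) f"
      proof (rule s.wsq_mono, rule eventually_mono[OF AE])
        fix x :: "nat \<Rightarrow> real" assume x: "(\<forall>i<3. 0 < x i) \<and> (\<Sum>i<3. x i) = 1"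
        have "0 < x 0" "0 < x (Suc 0)" "0 < x (Suc (Suc 0))" using x by auto
        moreover have "x 0 + x (Suc 0) + x (Suc (Suc 0)) = 1" using x by (simp add: numeral_3_eq_3)
        ultimately have "0 \<le> x i + x (Suc i)" "x i + x (Suc i) \<le> 1"
          using i by (auto simp: numeral_2_eq_2 less_Suc_eq)
        then have "(x i + x (Suc i)) powr m \<le> 1 powr m" using m by (intro powr_mono2) auto
        then show "s.pair_weight i (Suc i) x * (f x - 0)\<^sup>2 \<le> 1 * (f x)\<^sup>2"
          by (simp add: mult_left_le_one_le)
      qed
      also have "\<dots> < \<top>"
        unfolding s.wsq_def using nn_integral_eq_integral[OF i2] by simp
      finally show ?thesis .
    qed
    then have "dirichlet_nn \<gamma> m (1/3) 3 f < \<top>"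
      unfolding s.dirichlet_nn_eq_sum_bond by simp
    moreover have "0 < (\<integral>x. (f x)\<^sup>2 \<partial>?M)" using nz by (simp add: order_less_le)
    ultimately show ?thesis by (auto simp: ennreal_divide_eq_top_iff less_top[symmetric])
  qed
  finally show ?thesis .
qed

theorem theorem2:
  fixes \<gamma> m :: real
  assumes "\<gamma> > 0" and "m \<ge> 0"
  shows "\<exists>C > 0. \<forall>E > 0. \<forall>N::nat \<ge> 2.
           ennreal C * kappa \<gamma> m * ennreal (1 / (real N)\<^sup>2) * gap_lr \<gamma> m E N \<le> gap_nn \<gamma> m E N"
proof -
  obtain K where K: "kappa \<gamma> m = ennreal K" "K \<ge> 0"
    using kappa_finite[OF assms] by (cases "kappa \<gamma> m") auto
  \<comment> \<open>The factor that compares the two Dirichlet forms. It depends on \<open>m\<close>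
    and, through \<open>K\<close>, on \<gamma>, but not on \<open>E\<close> or \<open>N\<close>, so
    its inverse serves as \<open>C\<close>.\<close>
  define c where "c = 2 powr m * (25 * K + 24)"
  have c: "c > 0" using K(2) by (simp add: c_def add_nonneg_pos)
  show ?thesis
  proof (intro exI[of _ "1 / c"] conjI allI impI)
    show "1 / c > 0" using c by simp
    fix E :: real and N :: nat assume E: "E > 0" and N: "N \<ge> 2"
    interpret s: energy_simplex \<gamma> m E N using assms E N by unfold_locales auto
    show "ennreal (1 / c) * kappa \<gamma> m * ennreal (1 / (real N)\<^sup>2) * gap_lr \<gamma> m E N \<le> gap_nn \<gamma> m E N"
      unfolding gap_nn_def
    proof (rule INF_greatest)
      fix f assume t: "f \<in> test_fns \<gamma> E N"
      let ?V = "ennreal (\<integral>x. (f x)\<^sup>2 \<partial>nu_cond \<gamma> E N)"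
      have f: "f \<in> borel_measurable (config_space N)" and i2: "integrable (nu_cond \<gamma> E N) (\<lambda>x. (f x)\<^sup>2)"
        using t by (auto simp: test_fns_def)
      have fin: "(\<integral>\<^sup>+x. ennreal ((f x)\<^sup>2) \<partial>nu_cond \<gamma> E N) < \<infinity>"
        using nn_integral_eq_integral[OF i2] by simp
      have c0: "ennreal (1 / c) * ennreal (1 / (real N)\<^sup>2) * ennreal (c * (real N)\<^sup>2) = 1"
        using c N by (simp add: ennreal_mult[symmetric])
      \<comment> \<open>The forms are compared for each \<open>f\<close> separately; the same
        \<open>f\<close> serves as a test function for the long-range gap, and dividing by its norm
        gives the bound on every quotient.\<close>
      have "ennreal (1 / c) * kappa \<gamma> m * ennreal (1 / (real N)\<^sup>2) * gap_lr \<gamma> m E N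
        \<le> ennreal (1 / c) * kappa \<gamma> m * ennreal (1 / (real N)\<^sup>2) * (dirichlet_lr \<gamma> m E N f / ?V)"
        unfolding gap_lr_def using t by (intro mult_left_mono INF_lower) auto
      also have "\<dots> = ennreal (1 / c) * ennreal (1 / (real N)\<^sup>2) * (kappa \<gamma> m * dirichlet_lr \<gamma> m E N f) / ?V"
        by (simp add: divide_ennreal_def mult_ac)
      also have "\<dots> \<le> ennreal (1 / c) * ennreal (1 / (real N)\<^sup>2) * (ennreal (c * (real N)\<^sup>2) * dirichlet_nn \<gamma> m E N f) / ?V"
        unfolding c_def using K
        by (intro divide_right_mono_ennreal mult_left_mono s.kappa_dirichlet_lr_le f fin) auto
      also have "\<dots> = dirichlet_nn \<gamma> m E N f / ?V"
        by (simp add: mult.assoc[symmetric] c0)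
      finally show "ennreal (1 / c) * kappa \<gamma> m * ennreal (1 / (real N)\<^sup>2) * gap_lr \<gamma> m E N \<le> dirichlet_nn \<gamma> m E N f / ?V" .
    qed
  qed
qed

end
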